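(* Let $R>0$, let $p=\frac{p_0}{q_0}\ge1$ with $p_0,q_0$ positive integers, $p_0$ even and $(p_0,q_0)=1$, and let $M=\{x\in C[0,1]:\int_0^1x^p(t)\,dt\le R^p\}$. Let $m\ge1$ and let $s_j>0$, $r_j>0$ ($j=1,\dots,m$) satisfy $s_1+\cdots+s_m=1$ and $s_1r_1+\cdots+s_mr_m=1$. Suppose that the partition $0=t_0<t_1<\cdots<t_{n-1}<t_n=1$ of $[0,1]$ satisfies, with $\Delta t_k=t_k-t_{k-1}$, $$\Delta t_k=\frac{r_j}{n}\quad\text{for }k=(s_1+\cdots+s_{j-1})n+1,\dots,(s_1+\cdots+s_j)n,\quad j=1,\dots,m,$$ where $s_j$ are rational and $n$ runs through the positive integers for which all $s_jn$ are integers. Let $g:\mathbb{R}\to\mathbb{R}$ be a continuous function satisfying one of the following two conditions. ($H_1$) For some integer $k\ge1$: $g\in C^k(-\infty,+\infty)$, and $r(x)=x^{\frac1p-1}\{g(Rx^{\frac1p})+g(-Rx^{\frac1p})\}$ satisfies $r\in C^k[0,+\infty)$, $\lim_{x\to+\infty}r^{(j)}(x)e^{-x}=0$ for $j=0,\dots,k-1$, and $|r^{(k)}(x)|\le A$ for some positive number $A$. ($H_2$) $\displaystyle\int_0^{+\infty}x^{\frac1p+1}\,|g(Rx^{\frac1p})+g(-Rx^{\frac1p})|\,e^{-\frac xp}\,dx<+\infty.$ Then the average value of the functional $Y=\int_0^1g(x(t))\,dt$ on the ball $M$, computed with this discretization, is $$EY=\frac{1}{2R\,\Gamma(\frac1p)\,p^{\frac1p-1}}\int_{-\infty}^{+\infty}\Bigl\{\sum_{j=1}^ms_jr_j\,g\bigl(r_j^{-\frac1p}x\bigr)\Bigr\}\,e^{-\frac{x^p}{pR^p}}\,dx.$$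 Consequently the average values of functionals depend on the discretization: in general $EY$ takes different values for different choices of the parameters $m,(s_j),(r_j)$.
   Context: Since $p_0$ is even and coprime to $q_0$, $x^p=(x^{p_0})^{1/q_0}=|x|^p$ for all real $x$. Average value with respect to the given partitions: both $Y$ and $M$ are discretized with the same partition. With $x_k$ standing for the value of $x$ at a point of $(t_{k-1},t_k)$, put $Y_n=\sum_{k=1}^ng(x_k)\Delta t_k$, $M_n=\{(x_1,\dots,x_n)\in\mathbb{R}^n : x_1^p\Delta t_1+\cdots+x_n^p\Delta t_n\le R^p\}$, $dv_n=dx_1\cdots dx_n$, and $$EY=\lim_{n\to\infty}\frac{\int_{M_n}Y_n\,dv_n}{\int_{M_n}dv_n}.$$ The assertion includes that this limit exists.
   Formalization: The integral over the line is the limit of integrals over [-T,T]. The formula is proved, in [-∞,∞], whenever that integral has a value; that it (hence EY) exists and is finite is proved under (H1), or if (H2) holds for each g(r_j^{-1/p}x), as (H2) for g alone does not suffice. *)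

theory Defs
  imports "HOL-Analysis.Analysis"
begin

text \<open>The power \<open>x\<^sup>p\<close> for \<open>p = p0 / q0\<close>, read as \<open>(x\<^sup>p\<^sup>0)\<^sup>1\<^sup>/\<^sup>q\<^sup>0\<close>, so that it also makes sense
  for negative \<open>x\<close>; it equals \<open>\<bar>x\<bar> powr p\<close> when \<open>p0\<close> is even.\<close>

definition rat_pow :: "nat \<Rightarrow> nat \<Rightarrow> real \<Rightarrow> real" where
  "rat_pow p0 q0 x = root q0 (x ^ p0)"

subsection \<open>Partitions\<close>

definition mesh_parameters :: "nat \<Rightarrow> (nat \<Rightarrow> real) \<Rightarrow> (nat \<Rightarrow> real) \<Rightarrow> bool" where
  "mesh_parameters m s r \<longleftrightarrow> m \<ge> 1 \<and>
     (\<forall>j\<in>{1..m}. s j > 0 \<and> r j > 0 \<and> s j \<in> \<rat>) \<and>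
     (\<Sum>j=1..m. s j) = 1 \<and> (\<Sum>j=1..m. s j * r j) = 1"

text \<open>For rational weights these sizes include all multiples of a common denominator, so the
  limits along \<open>mesh_sequence\<close> below are taken along a nontrivial filter.\<close>

definition mesh_sizes :: "nat \<Rightarrow> (nat \<Rightarrow> real) \<Rightarrow> nat set" where
  "mesh_sizes m s = {n. n \<ge> 1 \<and> (\<forall>j\<in>{1..m}. s j * real n \<in> \<int>)}"

definition mesh_sequence :: "nat \<Rightarrow> (nat \<Rightarrow> real) \<Rightarrow> nat filter" where
  "mesh_sequence m s = inf sequentially (principal (mesh_sizes m s))"

text \<open>\<open>t n k\<close> is the \<open>k\<close>-th node of the partition of \<open>[0, 1]\<close> into \<open>n\<close> intervals; it is
  unconstrained when \<open>n\<close> is not an admissible size or \<open>k > n\<close>.\<close>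

definition mesh_partition ::
  "nat \<Rightarrow> (nat \<Rightarrow> real) \<Rightarrow> (nat \<Rightarrow> real) \<Rightarrow> (nat \<Rightarrow> nat \<Rightarrow> real) \<Rightarrow> bool" where
  "mesh_partition m s r t \<longleftrightarrow> (\<forall>n\<in>mesh_sizes m s.
     t n 0 = 0 \<and> t n n = 1 \<and> (\<forall>k\<in>{1..n}. t n (k - 1) < t n k) \<and>
     (\<forall>j\<in>{1..m}. \<forall>k.
        (\<Sum>i\<in>{1..<j}. s i) * real n + 1 \<le> real k \<and> real k \<le> (\<Sum>i\<in>{1..j}. s i) * real n \<longrightarrow>
        t n k - t n (k - 1) = r j / real n))"

subsection \<open>Discretized functionals and their averages\<close>

text \<open>The discretization of the functional \<open>x \<mapsto> \<integral>\<^sub>0\<^sup>1 h (x(u)) du\<close> for the partition with nodes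
  \<open>\<tau> 0, \<dots>, \<tau> n\<close>. The vector \<open>(x 1, \<dots>, x n)\<close> is a point of the product space
  \<open>\<Pi>\<^sub>M k\<in>{1..n}. lborel\<close>, whose measure is \<open>dx\<^sub>1 \<dots> dx\<^sub>n\<close>.\<close>

definition disc_functional :: "(real \<Rightarrow> real) \<Rightarrow> nat \<Rightarrow> (nat \<Rightarrow> real) \<Rightarrow> (nat \<Rightarrow> real) \<Rightarrow> real" where
  "disc_functional h n \<tau> x = (\<Sum>k=1..n. h (x k) * (\<tau> k - \<tau> (k - 1)))"

text \<open>The discretization of \<open>{x \<in> C[0,1]. \<integral>\<^sub>0\<^sup>1 \<phi> (x(u)) du \<le> c}\<close>. The ball of radius \<open>R\<close> is the case
  \<open>\<phi> x = x\<^sup>p\<close>, \<open>c = R\<^sup>p\<close>.\<close>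

definition disc_ball :: "(real \<Rightarrow> real) \<Rightarrow> real \<Rightarrow> nat \<Rightarrow> (nat \<Rightarrow> real) \<Rightarrow> (nat \<Rightarrow> real) set" where
  "disc_ball \<phi> c n \<tau> = {x \<in> space (\<Pi>\<^sub>M k\<in>{1..n}. lborel). disc_functional \<phi> n \<tau> x \<le> c}"

definition disc_average ::
  "(real \<Rightarrow> real) \<Rightarrow> (real \<Rightarrow> real) \<Rightarrow> real \<Rightarrow> nat \<Rightarrow> (nat \<Rightarrow> real) \<Rightarrow> real" where
  "disc_average g \<phi> c n \<tau> =
     (LINT x:disc_ball \<phi> c n \<tau>|(\<Pi>\<^sub>M k\<in>{1..n}. lborel). disc_functional g n \<tau> x) /
     (LINT x:disc_ball \<phi> c n \<tau>|(\<Pi>\<^sub>M k\<in>{1..n}. lborel). 1)"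

text \<open>\<open>EY\<close> exists and equals \<open>L\<close>. The value is an extended real because one of the growth
  conditions below allows \<open>EY = \<plusminus>\<infinity>\<close>.\<close>

definition has_average_value ::
  "(real \<Rightarrow> real) \<Rightarrow> nat \<Rightarrow> nat \<Rightarrow> real \<Rightarrow>
   nat \<Rightarrow> (nat \<Rightarrow> real) \<Rightarrow> (nat \<Rightarrow> nat \<Rightarrow> real) \<Rightarrow> ereal \<Rightarrow> bool" where
  "has_average_value g p0 q0 R m s t L \<longleftrightarrow>
     ((\<lambda>n. ereal (disc_average g (rat_pow p0 q0) (R powr (real p0 / real q0)) n (t n)))
        \<longlongrightarrow> L) (mesh_sequence m s)"

subsection \<open>The conditions on the integrand\<close>

text \<open>\<open>d 0, \<dots>, d k\<close> are the successive derivatives of the \<open>C\<^sup>k\<close> function \<open>d 0\<close> on \<open>S\<close>, one-sided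
  at boundary points of an interval \<open>S\<close>.\<close>

definition Ck_derivatives_on :: "nat \<Rightarrow> real set \<Rightarrow> (nat \<Rightarrow> real \<Rightarrow> real) \<Rightarrow> bool" where
  "Ck_derivatives_on k S d \<longleftrightarrow>
     (\<forall>j<k. \<forall>x\<in>S. (d j has_real_derivative d (Suc j) x) (at x within S)) \<and>
     continuous_on S (d k)"

text \<open>At \<open>x = 0\<close> the expression \<open>x powr (1/p - 1)\<close> has no meaning as a power of \<open>0\<close> when
  \<open>p > 1\<close> (HOL sets it to \<open>0\<close>), so \<open>r \<in> C\<^sup>k[0,\<infinity>)\<close> says that \<open>r\<close>, given by
  the formula on \<open>(0,\<infinity>)\<close>, extends to a \<open>C\<^sup>k\<close> function \<open>d 0\<close> on \<open>[0,\<infinity>)\<close>.\<close>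

definition condition_H1 :: "real \<Rightarrow> real \<Rightarrow> (real \<Rightarrow> real) \<Rightarrow> bool" where
  "condition_H1 p R g \<longleftrightarrow> (\<exists>k\<ge>1.
     (\<exists>e. e 0 = g \<and> Ck_derivatives_on k UNIV e) \<and>
     (\<exists>d. Ck_derivatives_on k {0..} d \<and>
          (\<forall>x>0. d 0 x = x powr (1/p - 1) * (g (R * x powr (1/p)) + g (- R * x powr (1/p)))) \<and>
          (\<forall>j<k. ((\<lambda>x. d j x * exp (- x)) \<longlongrightarrow> 0) at_top) \<and>
          (\<exists>A>0. \<forall>x\<ge>0. \<bar>d k x\<bar> \<le> A)))"

definition condition_H2 :: "real \<Rightarrow> real \<Rightarrow> (real \<Rightarrow> real) \<Rightarrow> bool" where
  "condition_H2 p R g \<longleftrightarrow> set_integrable lborel {0..}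
     (\<lambda>x. x powr (1/p + 1) * \<bar>g (R * x powr (1/p)) + g (- R * x powr (1/p))\<bar> * exp (- x / p))"

subsection \<open>Integrals over the real line\<close>

text \<open>Both conditions control only the even part of \<open>g\<close>. The integral over the line therefore has
  to be taken as the limit of the integrals over \<open>[-T, T]\<close>: for odd \<open>g\<close> of arbitrary growth all
  averages vanish, although the two half-line integrals may diverge.\<close>

definition has_line_integral :: "(real \<Rightarrow> real) \<Rightarrow> ereal \<Rightarrow> bool" where
  "has_line_integral f I \<longleftrightarrow> ((\<lambda>T. ereal (LINT x:{-T..T}|lborel. f x)) \<longlongrightarrow> I) at_top"

lemma has_line_integral_integrable:
  assumes "integrable lborel f"
  shows "has_line_integral f (ereal (LINT x|lborel. f x))"
proof -
  have meas: "f \<in> borel_measurable lborel"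
    using assms by (rule borel_measurable_integrable)
  have "((\<lambda>T. LINT x|lborel. indicator {-T..T} x *\<^sub>R f x) \<longlongrightarrow> (LINT x|lborel. f x)) at_top"
  proof (rule integral_dominated_convergence_at_top)
    show "integrable lborel (\<lambda>x. norm (f x))" using assms by simp
    show "AE x in lborel. ((\<lambda>T. indicator {-T..T} x *\<^sub>R f x) \<longlongrightarrow> f x) at_top"
    proof (rule AE_I2, rule tendsto_eventually)
      fix x :: real
      show "\<forall>\<^sub>F T in at_top. indicator {-T..T} x *\<^sub>R f x = f x"
        using eventually_ge_at_top[of "\<bar>x\<bar>"] by eventually_elim (auto simp: indicator_def)
    qed
    show "\<forall>\<^sub>F T in at_top. AE x in lborel. norm (indicator {-T..T} x *\<^sub>R f x) \<le> norm (f x)"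
      by (auto simp: indicator_def intro!: always_eventually)
  qed (use meas in auto)
  then show ?thesis
    by (simp add: has_line_integral_def set_lebesgue_integral_def)
qed

definition mixed_integrand ::
  "(real \<Rightarrow> real) \<Rightarrow> nat \<Rightarrow> nat \<Rightarrow> real \<Rightarrow> nat \<Rightarrow> (nat \<Rightarrow> real) \<Rightarrow> (nat \<Rightarrow> real) \<Rightarrow> real \<Rightarrow> real" where
  "mixed_integrand g p0 q0 R m s r x =
     (let p = real p0 / real q0 in
      (\<Sum>j=1..m. s j * r j * g (r j powr (- (1/p)) * x)) *
      exp (- (rat_pow p0 q0 x / (p * R powr p))))"

end

theory Submission
  imports Defs "HOL-Real_Asymp.Real_Asymp"
begin

text \<open>Fubini and scaling show that on the discretized ball a coordinate \<open>x\<^sub>k\<close> with weight \<open>r\<^sub>j / n\<close>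
  has, after the substitution \<open>x\<^sub>k = r\<^sub>j powr (-1/p) * u\<close>, a density proportional to
  \<open>(1 - z/n)\<^sub>+ powr ((n - 1)/p)\<close> with \<open>z = (\<bar>u\<bar>/R) powr p\<close>. So the average of \<open>Y\<^sub>n\<close> is the quotient of
  the integrals of \<open>G\<close> and of \<open>1\<close> against this weight, where \<open>G u = \<Sum>\<^sub>j s\<^sub>j r\<^sub>j g (r\<^sub>j powr (-1/p) * u)\<close>.
  The weight tends to \<open>exp (- z/p)\<close>, and its quotient by this limit is decreasing for \<open>z \<ge> 1\<close>.
  The second mean value theorem therefore yields an Abelian theorem: whenever the symmetric
  integrals of \<open>G * exp (- z/p)\<close> converge in the extended reals, the weighted integrals have
  the same limit. The growth conditions only serve to make this limit finite. For
  \<open>g x = \<bar>x\<bar> powr (2p - 1)\<close> the limit is proportional to \<open>\<Sum>\<^sub>j s\<^sub>j r\<^sub>j powr (1/p - 1)\<close>, which depends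
  on the mesh.\<close>

subsection \<open>Weighted balls\<close>

lemma rat_pow_eq_powr:
  assumes "even p0" "p0 > 0" "q0 > 0"
  shows "rat_pow p0 q0 x = \<bar>x\<bar> powr (real p0 / real q0)"
proof (cases "x = 0")
  case True
  then show ?thesis using assms by (simp add: rat_pow_def)
next
  case False
  have "rat_pow p0 q0 x = root q0 (\<bar>x\<bar> ^ p0)"
    using assms by (simp add: rat_pow_def power_even_abs)
  also have "\<dots> = (\<bar>x\<bar> ^ p0) powr (1 / real q0)"
    using assms False by (simp add: root_powr_inverse)
  also have "\<dots> = \<bar>x\<bar> powr (real p0 / real q0)"
    using False by (simp add: powr_realpow[symmetric] powr_powr)
  finally show ?thesis .
qed

text \<open>The index set is arbitrary so that volumes can be computed by adding one coordinate at a
  time. With \<open>I = {1..n}\<close>, the mesh widths as \<open>w\<close> and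
  \<open>c = R powr p\<close> this is the discretized ball.\<close>

definition weighted_ball :: "real \<Rightarrow> 'i set \<Rightarrow> ('i \<Rightarrow> real) \<Rightarrow> real \<Rightarrow> ('i \<Rightarrow> real) set" where
  "weighted_ball p I w c =
     {x \<in> space (\<Pi>\<^sub>M i\<in>I. lborel). (\<Sum>i\<in>I. w i * \<bar>x i\<bar> powr p) \<le> c}"

lemma weighted_ball_sets [measurable]:
  "finite I \<Longrightarrow> weighted_ball p I w c \<in> sets (\<Pi>\<^sub>M i\<in>I. lborel)"
  unfolding weighted_ball_def by measurable

text \<open>Tonelli: fixing coordinate \<open>k\<close> at \<open>u\<close> leaves a ball in the
  other coordinates whose level has dropped by \<open>w k * \<bar>u\<bar> powr p\<close>, possibly
  below zero.\<close>

lemma nn_integral_weighted_ball_insert: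
  fixes h :: "real \<Rightarrow> ennreal"
  assumes "finite I" "k \<notin> I" and [measurable]: "h \<in> borel_measurable borel"
  shows "(\<integral>\<^sup>+x. h (x k) * indicator (weighted_ball p (insert k I) w c) x
            \<partial>(\<Pi>\<^sub>M i\<in>insert k I. lborel)) =
         (\<integral>\<^sup>+u. h u * emeasure (\<Pi>\<^sub>M i\<in>I. lborel)
            (weighted_ball p I w (c - w k * \<bar>u\<bar> powr p)) \<partial>lborel)"
proof -
  interpret product_sigma_finite "\<lambda>_. lborel :: real measure" ..
  have [measurable]: "(\<lambda>x. x k) \<in> borel_measurable (\<Pi>\<^sub>M i\<in>insert k I. (lborel :: real measure))"
    using measurable_component_singleton[of k "insert k I" "\<lambda>_. lborel :: real measure"] by simp
  have [measurable]:
    "weighted_ball p (insert k I) w c \<in> sets (\<Pi>\<^sub>M i\<in>insert k I. lborel)"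
    using assms(1) by (intro weighted_ball_sets) simp
  have meas: "(\<lambda>x. h (x k) * indicator (weighted_ball p (insert k I) w c) x)
      \<in> borel_measurable (\<Pi>\<^sub>M i\<in>insert k I. lborel)"
    by measurable
  have "(\<integral>\<^sup>+x. h (x k) * indicator (weighted_ball p (insert k I) w c) x
            \<partial>(\<Pi>\<^sub>M i\<in>insert k I. lborel)) =
     (\<integral>\<^sup>+u. \<integral>\<^sup>+x. h ((x(k := u)) k) * indicator (weighted_ball p (insert k I) w c) (x(k := u))
            \<partial>(\<Pi>\<^sub>M i\<in>I. lborel) \<partial>lborel)"
    by (rule product_nn_integral_insert_rev[OF assms(1,2) meas])
  also have "\<dots> = (\<integral>\<^sup>+u. \<integral>\<^sup>+x. h u * indicator (weighted_ball p I w (c - w k * \<bar>u\<bar> powr p)) x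
            \<partial>(\<Pi>\<^sub>M i\<in>I. lborel) \<partial>lborel)"
  proof (intro nn_integral_cong)
    fix u :: real and x :: "'a \<Rightarrow> real"
    assume x: "x \<in> space (\<Pi>\<^sub>M i\<in>I. lborel)"
    have "(\<Sum>i\<in>I. w i * \<bar>(x(k := u)) i\<bar> powr p) = (\<Sum>i\<in>I. w i * \<bar>x i\<bar> powr p)"
      using assms(2) by (intro sum.cong) auto
    moreover have "x(k := u) \<in> space (\<Pi>\<^sub>M i\<in>insert k I. lborel)"
      using x by (auto simp: space_PiM PiE_def extensional_def)
    ultimately show "h ((x(k := u)) k) * indicator (weighted_ball p (insert k I) w c) (x(k := u)) =
      h u * indicator (weighted_ball p I w (c - w k * \<bar>u\<bar> powr p)) x"
      using x assms(1,2) by (auto simp: weighted_ball_def indicator_def algebra_simps)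
  qed
  also have "\<dots> = (\<integral>\<^sup>+u. h u * emeasure (\<Pi>\<^sub>M i\<in>I. lborel)
            (weighted_ball p I w (c - w k * \<bar>u\<bar> powr p)) \<partial>lborel)"
    using assms(1) by (intro nn_integral_cong) (simp add: nn_integral_cmult)
  finally show ?thesis .
qed

text \<open>Level 0 has to be excluded from the volume formula: for \<open>I = {}\<close> the ball
  of level 0 has measure 1, but \<open>0 powr 0 = 0\<close>. Slices hit level 0 for at most two
  values of \<open>u\<close>, a null set.\<close>

lemma AE_powr_level:
  fixes w c p :: real
  assumes "w > 0" "p > 0"
  shows "AE u in lborel. c - w * \<bar>u\<bar> powr p \<noteq> 0"
proof -
  have "{u. c - w * \<bar>u\<bar> powr p = 0} \<subseteq> {(c / w) powr (1 / p), - ((c / w) powr (1 / p))}"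
  proof
    fix u :: real
    assume "u \<in> {u. c - w * \<bar>u\<bar> powr p = 0}"
    then have "c / w = \<bar>u\<bar> powr p" using assms by (simp add: field_simps)
    then have "(c / w) powr (1 / p) = \<bar>u\<bar>" using assms by (simp add: powr_powr)
    then show "u \<in> {(c / w) powr (1 / p), - ((c / w) powr (1 / p))}" by auto
  qed
  then have "countable {u. c - w * \<bar>u\<bar> powr p = 0}"
    by (meson countable_finite finite.intros finite_subset)
  then have "{u. c - w * \<bar>u\<bar> powr p = 0} \<in> null_sets lborel"
    by (rule countable_imp_null_set_lborel)
  then show ?thesis
    by (rule AE_I') auto
qed

text \<open>The substitution \<open>u = s * v\<close> with \<open>s = (c / w) powr (1 / p)\<close>
  pulls out all dependence on \<open>c\<close> and \<open>w\<close> and leaves a Beta integral. Only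
  its positivity and finiteness matter, because such constants cancel in the averages.\<close>

lemma powr_weight_nn_integral:
  fixes w p a :: real
  assumes "w > 0" "p > 0" "a \<ge> 0"
  shows "\<exists>J>0. \<forall>c. c \<noteq> 0 \<longrightarrow>
    (\<integral>\<^sup>+u. ennreal (max 0 (c - w * \<bar>u\<bar> powr p) powr a) \<partial>lborel) =
      ennreal (J * max 0 c powr (a + 1 / p))"
proof -
  define f where "f u = max 0 (1 - \<bar>u\<bar> powr p) powr a" for u :: real
  define J where "J = (\<integral>\<^sup>+u. ennreal (f u) \<partial>lborel)"
  have [measurable]: "f \<in> borel_measurable borel" unfolding f_def by measurable
  have "J \<le> (\<integral>\<^sup>+u. indicator {-1..1::real} u \<partial>lborel)"
    unfolding J_def
  proof (intro nn_integral_mono)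
    fix u :: real
    have "f u = 0" if "\<bar>u\<bar> > 1"
      using that ge_one_powr_ge_zero[of "\<bar>u\<bar>" p] assms by (auto simp: f_def max_def)
    moreover have "f u \<le> 1"
      unfolding f_def using assms by (intro powr_le1) auto
    ultimately show "ennreal (f u) \<le> indicator {-1..1} u"
      by (cases "\<bar>u\<bar> > 1") (auto simp: indicator_def)
  qed
  also have "\<dots> < \<infinity>" by simp
  finally have fin: "J < \<infinity>" .
  \<comment> \<open>\<open>b\<close> is the value of \<open>f\<close> at \<open>1/2\<close>, a
    positive lower bound for \<open>f\<close> on \<open>[-1/2, 1/2]\<close>.\<close>
  define b where "b = (1 - (1/2) powr p) powr a"
  have half: "(1/2::real) powr p < 1" using assms powr_less_mono2[of p "1/2" 1] by simp
  have b: "b > 0" using half assms by (simp add: b_def)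
  have "0 < (\<integral>\<^sup>+u. ennreal b * indicator {-1/2..1/2::real} u \<partial>lborel)"
    using b by (simp add: nn_integral_cmult ennreal_zero_less_mult_iff)
  also have "\<dots> \<le> J" unfolding J_def
  proof (intro nn_integral_mono)
    fix u :: real
    show "ennreal b * indicator {-1/2..1/2} u \<le> ennreal (f u)"
    proof (cases "u \<in> {-1/2..1/2}")
      case True
      then have "\<bar>u\<bar> powr p \<le> (1/2) powr p" using assms by (intro powr_mono2) auto
      then have "b \<le> f u" unfolding b_def f_def using half assms by (intro powr_mono2) auto
      then show ?thesis using True by (simp add: ennreal_leI)
    qed auto
  qed
  finally have pos: "J > 0" .
  obtain j where j: "J = ennreal j" "j > 0"
    using fin pos by (cases J) auto
  have w0: "w powr (-1/p) > 0" using assms by simp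
  show ?thesis
  proof (intro exI[of _ "w powr (-1/p) * j"] conjI allI impI)
    show "w powr (-1/p) * j > 0" using w0 j by simp
    fix c :: real
    assume "c \<noteq> 0"
    show "(\<integral>\<^sup>+u. ennreal (max 0 (c - w * \<bar>u\<bar> powr p) powr a) \<partial>lborel) =
      ennreal (w powr (-1/p) * j * max 0 c powr (a + 1 / p))"
    proof (cases "c > 0")
      case False
      have "max 0 (c - w * \<bar>u\<bar> powr p) = 0" for u
        using False mult_nonneg_nonneg[of w "\<bar>u\<bar> powr p"] \<open>w > 0\<close>
        by (auto simp: max_def simp del: zero_le_mult_iff mult_nonneg_nonneg)
      then show ?thesis using False by (simp add: max_def)
    next
      case True
      define s where "s = (c / w) powr (1 / p)"
      have s: "s > 0" using True assms by (simp add: s_def)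
      have sp: "s powr p = c / w" using True assms by (simp add: s_def powr_powr)
      have "(\<integral>\<^sup>+u. ennreal (max 0 (c - w * \<bar>u\<bar> powr p) powr a) \<partial>lborel) =
        ennreal \<bar>s\<bar> * (\<integral>\<^sup>+u. ennreal (max 0 (c - w * \<bar>0 + s * u\<bar> powr p) powr a) \<partial>lborel)"
        using s by (intro nn_integral_real_affine) auto
      also have "(\<lambda>u. ennreal (max 0 (c - w * \<bar>0 + s * u\<bar> powr p) powr a)) =
          (\<lambda>u. ennreal (c powr a) * ennreal (f u))"
      proof
        fix u :: real
        have "\<bar>0 + s * u\<bar> powr p = c / w * \<bar>u\<bar> powr p"
          using s by (simp add: abs_mult powr_mult sp)
        then have "max 0 (c - w * \<bar>0 + s * u\<bar> powr p) = c * max 0 (1 - \<bar>u\<bar> powr p)"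
          using True assms by (simp add: max_def field_simps)
        then show "ennreal (max 0 (c - w * \<bar>0 + s * u\<bar> powr p) powr a) =
           ennreal (c powr a) * ennreal (f u)"
          using True by (simp add: powr_mult f_def ennreal_mult)
      qed
      also have "ennreal \<bar>s\<bar> * (\<integral>\<^sup>+u. ennreal (c powr a) * ennreal (f u) \<partial>lborel) =
         ennreal s * (ennreal (c powr a) * ennreal j)"
        using s by (simp add: nn_integral_cmult flip: J_def j(1))
      also have "\<dots> = ennreal (s * (c powr a * j))"
        using s j by (simp add: ennreal_mult)
      also have "s * (c powr a * j) = w powr (-1/p) * j * max 0 c powr (a + 1 / p)"
      proof -
        have "s = c powr (1 / p) * w powr (-1 / p)"
          using True assms by (simp add: s_def powr_divide powr_minus field_simps)
        then show ?thesis using True by (simp add: powr_add mult_ac)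
      qed
      finally show ?thesis .
    qed
  qed
qed

text \<open>Induction on \<open>I\<close>: slicing off one coordinate raises the exponent by
  \<open>1 / p\<close>, and the constants multiply.\<close>

lemma emeasure_weighted_ball:
  fixes p :: real
  assumes "finite I" "\<And>i. i \<in> I \<Longrightarrow> w i > 0" "p > 0"
  shows "\<exists>K>0. \<forall>c. c \<noteq> 0 \<longrightarrow> emeasure (\<Pi>\<^sub>M i\<in>I. lborel) (weighted_ball p I w c) =
           ennreal (K * max 0 c powr (real (card I) / p))"
  using assms(1,2)
proof (induction I rule: finite_induct)
  case empty
  show ?case
  proof (intro exI[of _ 1] conjI allI impI)
    fix c :: real
    assume "c \<noteq> 0"
    then show "emeasure (\<Pi>\<^sub>M i\<in>{}. lborel) (weighted_ball p {} w c) =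
           ennreal (1 * max 0 c powr (real (card {}) / p))"
      by (cases "c > 0") (auto simp: weighted_ball_def PiM_empty max_def)
  qed simp
next
  case (insert k I)
  then obtain K where K: "K > 0" "\<And>c. c \<noteq> 0 \<Longrightarrow>
      emeasure (\<Pi>\<^sub>M i\<in>I. lborel) (weighted_ball p I w c) =
        ennreal (K * max 0 c powr (real (card I) / p))"
    by auto
  obtain J where J: "J > 0" "\<And>c. c \<noteq> 0 \<Longrightarrow>
      (\<integral>\<^sup>+u. ennreal (max 0 (c - w k * \<bar>u\<bar> powr p) powr (real (card I) / p)) \<partial>lborel) =
        ennreal (J * max 0 c powr (real (card I) / p + 1 / p))"
    using powr_weight_nn_integral[of "w k" p "real (card I) / p"] insert.prems \<open>p > 0\<close> by auto
  show ?case
  proof (intro exI[of _ "K * J"] conjI allI impI)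
    fix c :: real
    assume c: "c \<noteq> 0"
    have "emeasure (\<Pi>\<^sub>M i\<in>insert k I. lborel) (weighted_ball p (insert k I) w c) =
      (\<integral>\<^sup>+x. 1 * indicator (weighted_ball p (insert k I) w c) x \<partial>(\<Pi>\<^sub>M i\<in>insert k I. lborel))"
      using insert.hyps by simp
    also have "\<dots> = (\<integral>\<^sup>+u. 1 * emeasure (\<Pi>\<^sub>M i\<in>I. lborel)
            (weighted_ball p I w (c - w k * \<bar>u\<bar> powr p)) \<partial>lborel)"
      using insert.hyps by (intro nn_integral_weighted_ball_insert) auto
    \<comment> \<open>The induction hypothesis is silent at level 0, so the formula for the slices
      holds only for almost all \<open>u\<close>.\<close>
    also have "\<dots> = (\<integral>\<^sup>+u. ennreal K *
         ennreal (max 0 (c - w k * \<bar>u\<bar> powr p) powr (real (card I) / p)) \<partial>lborel)"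
      using AE_powr_level[of "w k" p c] insert.prems \<open>p > 0\<close> K(1)
      by (intro nn_integral_cong_AE) (auto elim!: eventually_mono simp: K(2) ennreal_mult)
    also have "\<dots> = ennreal K * ennreal (J * max 0 c powr (real (card I) / p + 1 / p))"
      by (simp add: nn_integral_cmult J(2)[OF c])
    also have "\<dots> = ennreal (K * J * max 0 c powr (real (card (insert k I)) / p))"
      using K J insert.hyps by (simp add: ennreal_mult[symmetric] add_divide_distrib mult.assoc add.commute)
    finally show "emeasure (\<Pi>\<^sub>M i\<in>insert k I. lborel) (weighted_ball p (insert k I) w c) =
      ennreal (K * J * max 0 c powr (real (card (insert k I)) / p))" .
  qed (use K J in auto)
qed

text \<open>The density of coordinate \<open>k\<close> at \<open>u\<close> is the volume of the
  slice there; \<open>card I - 1\<close> coordinates remain, hence the exponent.\<close>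

lemma distr_weighted_ball:
  fixes p :: real
  assumes "finite I" "k \<in> I" "\<forall>i\<in>I. w i > 0" "p > 0"
  shows "\<exists>K>0. distr (density (\<Pi>\<^sub>M i\<in>I. lborel) (indicator (weighted_ball p I w c)))
             borel (\<lambda>x. x k) =
           density lborel (\<lambda>u. ennreal (K * max 0 (c - w k * \<bar>u\<bar> powr p)
             powr ((real (card I) - 1) / p)))"
proof -
  define I' where "I' = I - {k}"
  have I: "I = insert k I'" "k \<notin> I'" "finite I'" and cardI: "real (card I) - 1 = real (card I')"
    using assms card_Suc_Diff1[of I k] by (auto simp: I'_def insert_absorb)
  obtain K where K: "K > 0" "\<And>c. c \<noteq> 0 \<Longrightarrow>
      emeasure (\<Pi>\<^sub>M i\<in>I'. lborel) (weighted_ball p I' w c) =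
        ennreal (K * max 0 c powr (real (card I') / p))"
    using emeasure_weighted_ball[of I' w p] assms I by auto
  have [measurable]: "(\<lambda>x. x k) \<in> measurable (\<Pi>\<^sub>M i\<in>I. (lborel :: real measure)) borel"
    using measurable_component_singleton[of k I "\<lambda>_. lborel :: real measure"] assms(2) by simp
  show ?thesis
  proof (intro exI[of _ K] conjI K(1) measure_eqI)
    fix A :: "real set"
    assume "A \<in> sets (distr (density (\<Pi>\<^sub>M i\<in>I. lborel)
      (indicator (weighted_ball p I w c))) borel (\<lambda>x. x k))"
    then have A [measurable]: "A \<in> sets borel" by simp
    have "emeasure (distr (density (\<Pi>\<^sub>M i\<in>I. lborel) (indicator (weighted_ball p I w c)))
             borel (\<lambda>x. x k)) A =
        emeasure (density (\<Pi>\<^sub>M i\<in>I. lborel) (indicator (weighted_ball p I w c)))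
             ((\<lambda>x. x k) -` A \<inter> space (\<Pi>\<^sub>M i\<in>I. lborel))"
      by (subst emeasure_distr) auto
    also have "\<dots> = (\<integral>\<^sup>+x. indicator (weighted_ball p I w c) x *
        indicator ((\<lambda>x. x k) -` A \<inter> space (\<Pi>\<^sub>M i\<in>I. lborel)) x \<partial>(\<Pi>\<^sub>M i\<in>I. lborel))"
      using assms(1) by (subst emeasure_density) auto
    also have "\<dots> = (\<integral>\<^sup>+x. indicator A (x k) * indicator (weighted_ball p I w c) x
        \<partial>(\<Pi>\<^sub>M i\<in>I. lborel))"
      by (intro nn_integral_cong) (auto simp: indicator_def)
    also have "\<dots> = (\<integral>\<^sup>+u. indicator A u * emeasure (\<Pi>\<^sub>M i\<in>I'. lborel)
            (weighted_ball p I' w (c - w k * \<bar>u\<bar> powr p)) \<partial>lborel)"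
      unfolding I(1) using I by (intro nn_integral_weighted_ball_insert) auto
    also have "\<dots> = (\<integral>\<^sup>+u. ennreal (K * max 0 (c - w k * \<bar>u\<bar> powr p)
             powr ((real (card I) - 1) / p)) * indicator A u \<partial>lborel)"
      using AE_powr_level[of "w k" p c] assms
      by (intro nn_integral_cong_AE) (auto elim!: eventually_mono simp: K(2) cardI mult.commute)
    also have "\<dots> = emeasure (density lborel (\<lambda>u. ennreal (K * max 0 (c - w k * \<bar>u\<bar> powr p)
             powr ((real (card I) - 1) / p)))) A"
      by (subst emeasure_density) auto
    finally show "emeasure (distr (density (\<Pi>\<^sub>M i\<in>I. lborel) (indicator (weighted_ball p I w c)))
             borel (\<lambda>x. x k)) A = \<dots>" .
  qed simp
qed

text \<open>\<open>K\<close> is chosen before \<open>g\<close>, so the same constant serves for a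
  given integrand and for the constant 1 and drops out of their quotient.\<close>

lemma set_integral_weighted_ball:
  fixes p :: real
  assumes "finite I" "k \<in> I" "\<forall>i\<in>I. w i > 0" "p > 0"
  shows "\<exists>K>0. \<forall>g\<in>borel_measurable borel.
     (LINT x:weighted_ball p I w c|(\<Pi>\<^sub>M i\<in>I. lborel). g (x k)) =
       K * (LINT u|lborel. g u * max 0 (c - w k * \<bar>u\<bar> powr p) powr ((real (card I) - 1) / p)) \<and>
     (integrable lborel (\<lambda>u. g u * max 0 (c - w k * \<bar>u\<bar> powr p) powr ((real (card I) - 1) / p)) \<longrightarrow>
       set_integrable (\<Pi>\<^sub>M i\<in>I. lborel) (weighted_ball p I w c) (\<lambda>x. g (x k)))"
proof -
  obtain K where K: "K > 0" and
    eq: "distr (density (\<Pi>\<^sub>M i\<in>I. lborel) (indicator (weighted_ball p I w c)))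
             borel (\<lambda>x. x k) =
           density lborel (\<lambda>u. ennreal (K * max 0 (c - w k * \<bar>u\<bar> powr p)
             powr ((real (card I) - 1) / p)))" (is "distr ?D _ _ = density _ ?d")
    using distr_weighted_ball[OF assms, where c = c] by auto
  have comp [measurable]: "(\<lambda>x. x k) \<in> measurable (\<Pi>\<^sub>M i\<in>I. (lborel :: real measure)) borel"
    using measurable_component_singleton[of k I "\<lambda>_. lborel :: real measure"] assms(2) by simp
  have D: "?D = density (\<Pi>\<^sub>M i\<in>I. lborel) (\<lambda>x. ennreal (indicator (weighted_ball p I w c) x))"
    by (intro arg_cong2[where f = density]) (auto simp: indicator_def)
  have meas: "(\<lambda>x. x k) \<in> measurable ?D borel" by simp
  note [measurable] = weighted_ball_sets[OF assms(1), where p = p and w = w and c = c]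
  show ?thesis
  proof (intro exI[of _ K] conjI K ballI impI)
    fix g :: "real \<Rightarrow> real"
    assume g [measurable]: "g \<in> borel_measurable borel"
    have "(LINT x:weighted_ball p I w c|(\<Pi>\<^sub>M i\<in>I. lborel). g (x k)) = (LINT x|?D. g (x k))"
      unfolding set_lebesgue_integral_def D by (subst integral_density) auto
    also have "\<dots> = (LINT u|density lborel ?d. g u)"
      unfolding eq[symmetric] by (subst integral_distr[OF meas]) auto
    also have "\<dots> = (LINT u|lborel. K * (g u * max 0 (c - w k * \<bar>u\<bar> powr p)
          powr ((real (card I) - 1) / p)))"
      using K by (subst integral_density) (auto simp: mult_ac)
    finally show "(LINT x:weighted_ball p I w c|(\<Pi>\<^sub>M i\<in>I. lborel). g (x k)) =
       K * (LINT u|lborel. g u * max 0 (c - w k * \<bar>u\<bar> powr p) powr ((real (card I) - 1) / p))"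
      by simp
    assume "integrable lborel
      (\<lambda>u. g u * max 0 (c - w k * \<bar>u\<bar> powr p) powr ((real (card I) - 1) / p))"
    from integrable_mult_right[OF this, of K]
    have "integrable (density lborel ?d) g"
      using K by (subst integrable_density) (auto simp: mult_ac)
    then have "integrable ?D (\<lambda>x. g (x k))"
      unfolding eq[symmetric] by (subst (asm) integrable_distr_eq[OF meas]) auto
    then show "set_integrable (\<Pi>\<^sub>M i\<in>I. lborel) (weighted_ball p I w c) (\<lambda>x. g (x k))"
      unfolding D set_integrable_def by (subst (asm) integrable_density) auto
  qed
qed

subsection \<open>Passage to the limit\<close>

text \<open>Up to a constant, the density of a coordinate rescaled to mesh weight
  \<open>1 / n\<close>, as a function of \<open>z = (\<bar>u\<bar> / R) powr p\<close>.\<close>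

definition trunc_weight :: "real \<Rightarrow> real \<Rightarrow> real \<Rightarrow> real" where
  "trunc_weight p n z = max 0 (1 - z / n) powr ((n - 1) / p)"

lemma trunc_weight_nonneg [simp]: "trunc_weight p n z \<ge> 0"
  by (simp add: trunc_weight_def)

lemma trunc_weight_eq_0: "n > 0 \<Longrightarrow> n \<le> z \<Longrightarrow> trunc_weight p n z = 0"
  by (simp add: trunc_weight_def max_def field_simps)

lemma trunc_weight_le_1:
  assumes "n \<ge> 1" "p > 0" "z \<ge> 0"
  shows "trunc_weight p n z \<le> 1"
  unfolding trunc_weight_def using assms by (intro powr_le1) auto

lemma trunc_weight_tendsto:
  assumes "p > 0"
  shows "(\<lambda>n. trunc_weight p (real n) z) \<longlonglongrightarrow> exp (- z / p)"
proof -
  have "((\<lambda>n. (1 - z / real n) powr ((real n - 1) / p)) \<longlongrightarrow> exp (- z / p)) sequentially"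
    using assms by (real_asymp simp: divide_simps)
  \<comment> \<open>For \<open>n > \<bar>z\<bar>\<close> the truncation at 0 is inactive.\<close>
  moreover have "eventually (\<lambda>n. (1 - z / real n) powr ((real n - 1) / p) =
      trunc_weight p (real n) z) sequentially"
    using eventually_gt_at_top[of "nat \<lceil>\<bar>z\<bar>\<rceil>"]
  proof eventually_elim
    case (elim n)
    then have "\<bar>z\<bar> < real n" by linarith
    then show ?case by (simp add: trunc_weight_def max_def field_simps)
  qed
  ultimately show ?thesis by (rule Lim_transform_eventually)
qed

lemma continuous_on_trunc_weight [continuous_intros]:
  assumes "n > 1" "p > 0" "continuous_on A f"
  shows "continuous_on A (\<lambda>u. trunc_weight p n (f u))"
  unfolding trunc_weight_def using assms
  by (intro continuous_on_powr' continuous_intros) auto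

text \<open>The tilted weight increases up to \<open>z = 1\<close> and decreases afterwards; the bound
  \<open>1 - x \<le> exp (- x)\<close> with \<open>x = (y - z) / (n - z)\<close> gives this without derivatives.\<close>

lemma trunc_weight_exp_antimono:
  assumes "n > 1" "p > 0" "1 \<le> z" "z \<le> y"
  shows "trunc_weight p n y * exp (y / p) \<le> trunc_weight p n z * exp (z / p)"
proof (cases "y < n")
  case False
  then show ?thesis using assms by (simp add: trunc_weight_eq_0)
next
  case True
  define x where "x = (y - z) / (n - z)"
  have nz: "n - z > 0" using True assms by simp
  \<comment> \<open>Passing from \<open>z\<close> to \<open>y\<close> multiplies the base
    \<open>1 - z / n\<close> by \<open>1 - x\<close>.\<close>
  have 1: "1 - y / n = (1 - z / n) * (1 - x)"
    using nz assms by (simp add: x_def field_simps)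
  have x: "0 \<le> x" "x < 1" using nz assms True by (auto simp: x_def)
  have zn: "1 - z / n > 0" using nz assms by (simp add: field_simps)
  have "(1 - x) powr ((n - 1) / p) \<le> exp (- x) powr ((n - 1) / p)"
    using x assms exp_ge_add_one_self[of "- x"] by (intro powr_mono2) auto
  also have "\<dots> = exp (- (x * (n - 1) / p))"
    by (simp add: powr_def)
  also have "\<dots> \<le> exp ((z - y) / p)"
  proof -
    \<comment> \<open>This is where \<open>z \<ge> 1\<close> enters: the exponent carries
      \<open>n - 1\<close>, while \<open>x\<close> has denominator \<open>n - z\<close>.\<close>
    have "x * (n - 1) \<ge> x * (n - z)" using x assms by (intro mult_left_mono) auto
    then have "x * (n - 1) \<ge> y - z" using nz by (simp add: x_def)
    then have "(y - z) / p \<le> x * (n - 1) / p" using assms by (intro divide_right_mono) auto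
    then show ?thesis by (simp add: diff_divide_distrib)
  qed
  finally have le: "(1 - x) powr ((n - 1) / p) \<le> exp ((z - y) / p)" .
  have "trunc_weight p n y * exp (y / p) =
      (1 - z / n) powr ((n - 1) / p) * (1 - x) powr ((n - 1) / p) * exp (y / p)"
    using zn x by (simp add: trunc_weight_def 1 max_def powr_mult)
  also have "\<dots> \<le> (1 - z / n) powr ((n - 1) / p) * exp ((z - y) / p) * exp (y / p)"
    using le by (intro mult_right_mono mult_left_mono) auto
  also have "\<dots> = trunc_weight p n z * exp (z / p)"
    using zn by (simp add: trunc_weight_def max_def mult.assoc diff_divide_distrib flip: exp_add)
  finally show ?thesis .
qed

text \<open>\<open>h\<close> already contains the limit weight, and the remaining factor
  \<open>v\<close> is the tilted weight, which tends to 1 pointwise. On a fixed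
  \<open>[0, T]\<close> dominated convergence applies. On the tail \<open>v\<close> decreases to 0,
  so the second mean value theorem gives \<open>v n T\<close> times some
  \<open>integral {T..c} h\<close>, bounded below by \<open>K - integral {0..T} h\<close>. Only
  one-sided bounds on the integrals of \<open>h\<close> enter, which brings conditional convergence
  and infinite limits within reach.\<close>

lemma eventually_weighted_integral_gt:
  fixes h :: "real \<Rightarrow> real"
  assumes h: "continuous_on {0..} h" and p: "p > 0" and R: "R > 0"
    and ev: "eventually (\<lambda>T. integral {0..T} h > K) at_top" and "K' < K"
  shows "eventually (\<lambda>n. integral {0..R * real n powr (1 / p)}
     (\<lambda>u. trunc_weight p (real n) ((u / R) powr p) * exp ((u / R) powr p / p) * h u) > K')
     sequentially"
proof -
  define v where "v n u = trunc_weight p (real n) ((u / R) powr p) * exp ((u / R) powr p / p)"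
    for n u
  define B where "B n = R * real n powr (1 / p)" for n
  \<comment> \<open>\<open>T \<ge> R\<close> gives \<open>(u / R) powr p \<ge> 1\<close> on the
    tail, the range where the tilted weight decreases.\<close>
  obtain T where T: "T \<ge> R" "\<And>S. S \<ge> T \<Longrightarrow> integral {0..S} h > K"
    using ev by (auto simp: eventually_at_top_linorder) (metis max.bounded_iff max.cobounded1)
  have T0: "T > 0" using T R by simp
  have h_int: "h integrable_on {a..b}" if "0 \<le> a" for a b
    using that by (intro integrable_continuous_real continuous_on_subset[OF h]) auto
  have v_cont: "continuous_on A (v n)" if "n \<ge> 2" "A \<subseteq> {0..}" for n A
    unfolding v_def using that p R
    by (intro continuous_intros continuous_on_powr') (auto simp: subset_iff)
  have v_lim: "(\<lambda>n. v n u) \<longlonglongrightarrow> 1" for u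
    using tendsto_mult[OF trunc_weight_tendsto[OF p, of "(u / R) powr p"]
        tendsto_const[of "exp ((u / R) powr p / p)"]]
    by (auto simp: v_def simp flip: exp_add)
  have head: "(\<lambda>n. integral {0..T} (\<lambda>u. v n u * h u)) \<longlonglongrightarrow> integral {0..T} h"
  proof -
    \<comment> \<open>The shift by 2 secures \<open>n > 1\<close>, for which the weights are
      continuous.\<close>
    have "(\<lambda>n. integral {0..T} (\<lambda>u. v (n + 2) u * h u)) \<longlonglongrightarrow> integral {0..T} h"
    proof (rule dominated_convergence(2))
      show "(\<lambda>u. v (n + 2) u * h u) integrable_on {0..T}" for n
        by (intro integrable_continuous_real continuous_on_mult v_cont
            continuous_on_subset[OF h]) auto
      show "(\<lambda>u. exp ((T / R) powr p / p) * \<bar>h u\<bar>) integrable_on {0..T}"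
        by (intro integrable_continuous_real continuous_intros continuous_on_subset[OF h]) auto
      show "norm (v (n + 2) u * h u) \<le> exp ((T / R) powr p / p) * \<bar>h u\<bar>"
        if "u \<in> {0..T}" for n u
      proof -
        have "(u / R) powr p \<le> (T / R) powr p"
          using that R p by (intro powr_mono2 divide_right_mono) auto
        then have "v (n + 2) u \<le> 1 * exp ((T / R) powr p / p)"
          unfolding v_def using p
          by (intro mult_mono trunc_weight_le_1) (auto simp: divide_right_mono)
        then show ?thesis
          by (auto simp: abs_mult v_def intro!: mult_right_mono)
      qed
      show "(\<lambda>n. v (n + 2) u * h u) \<longlonglongrightarrow> h u" for u
        using tendsto_mult[OF LIMSEQ_ignore_initial_segment[OF v_lim[of u], of 2] tendsto_const]
        by auto
    qed
    then show ?thesis by (rule LIMSEQ_offset)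
  qed
  \<comment> \<open>A lower bound for head plus tail; since \<open>v n T\<close> tends to 1, it
    converges to \<open>K\<close>, which exceeds \<open>K'\<close>.\<close>
  have "(\<lambda>n. integral {0..T} (\<lambda>u. v n u * h u) + v n T * (K - integral {0..T} h))
       \<longlonglongrightarrow> integral {0..T} h + 1 * (K - integral {0..T} h)"
    by (intro tendsto_intros head v_lim)
  then have "eventually (\<lambda>n. integral {0..T} (\<lambda>u. v n u * h u) +
      v n T * (K - integral {0..T} h) > K') sequentially"
    using \<open>K' < K\<close> by (intro order_tendstoD(1)) auto
  moreover have "filterlim B at_top sequentially"
    unfolding B_def using p R by real_asymp
  then have "eventually (\<lambda>n. B n \<ge> T) sequentially"
    by (simp add: filterlim_at_top)
  ultimately have "eventually (\<lambda>n. integral {0..B n} (\<lambda>u. v n u * h u) > K') sequentially"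
    using eventually_ge_at_top[of 2]
  proof eventually_elim
    case (elim n)
    have vh: "(\<lambda>u. v n u * h u) integrable_on {a..b}" if "a \<ge> 0" for a b
      using that elim
      by (intro integrable_continuous_real continuous_on_mult v_cont continuous_on_subset[OF h]) auto
    \<comment> \<open>\<open>B n\<close> is the radius at which \<open>z = n\<close>; the weight
      vanishes there, and the second boundary term drops out.\<close>
    have "(B n / R) powr p = real n" using R p elim by (simp add: B_def powr_powr)
    then have vB: "v n (B n) = 0" using elim by (simp add: v_def trunc_weight_eq_0)
    \<comment> \<open>The mean value theorem is stated for increasing factors, hence the minus
      sign.\<close>
    obtain c where c: "c \<in> {T..B n}" and
      "integral {T..B n} (\<lambda>u. - v n u * h u) =
        - v n T * integral {T..c} h + - v n (B n) * integral {c..B n} h"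
    proof (rule second_mean_value_theorem[of h T "B n" "\<lambda>u. - v n u"])
      show "h integrable_on {T..B n}" using T0 by (intro h_int) simp
      show "T \<le> B n" using elim by simp
      fix x y assume "T \<le> x" "x \<le> y" "y \<le> B n"
      moreover have "1 powr p \<le> (x / R) powr p"
        using R p T \<open>T \<le> x\<close> by (intro powr_mono2) auto
      moreover have "(x / R) powr p \<le> (y / R) powr p"
        using R p T \<open>T \<le> x\<close> \<open>x \<le> y\<close> by (intro powr_mono2 divide_right_mono) auto
      ultimately show "- v n x \<le> - v n y"
        unfolding v_def using p elim
        by (simp add: trunc_weight_exp_antimono)
    qed
    then have tail: "integral {T..B n} (\<lambda>u. v n u * h u) = v n T * integral {T..c} h"
      by (simp add: vB)
    have "integral {0..c} h = integral {0..T} h + integral {T..c} h"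
      using c T0 by (intro Henstock_Kurzweil_Integration.integral_combine[symmetric] h_int) auto
    then have "integral {T..c} h \<ge> K - integral {0..T} h"
      using T(2)[of c] c by simp
    then have "v n T * (K - integral {0..T} h) \<le> v n T * integral {T..c} h"
      by (intro mult_left_mono) (auto simp: v_def)
    moreover have "integral {0..B n} (\<lambda>u. v n u * h u) =
       integral {0..T} (\<lambda>u. v n u * h u) + integral {T..B n} (\<lambda>u. v n u * h u)"
      using elim T0
      by (intro Henstock_Kurzweil_Integration.integral_combine[symmetric] vh) auto
    ultimately show ?case using elim tail by simp
  qed
  then show ?thesis by (simp add: v_def B_def)
qed

text \<open>Convergence in the order topology amounts to two one-sided bounds: the lower one is the
  preceding estimate for \<open>h\<close>, the upper one the same estimate for \<open>- h\<close>.
  This treats finite and infinite \<open>I\<close> alike.\<close>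

lemma weighted_integral_tendsto:
  fixes h :: "real \<Rightarrow> real"
  assumes h: "continuous_on {0..} h" and p: "p > 0" and R: "R > 0"
    and lim: "((\<lambda>T. ereal (integral {0..T} h)) \<longlongrightarrow> I) at_top"
  shows "(\<lambda>n. ereal (integral {0..R * real n powr (1 / p)}
     (\<lambda>u. trunc_weight p (real n) ((u / R) powr p) * exp ((u / R) powr p / p) * h u)))
     \<longlonglongrightarrow> I"
proof (rule order_tendstoI)
  fix a assume "a < I"
  then obtain b where b: "a < ereal b" "ereal b < I" using ereal_dense2 by blast
  \<comment> \<open>Two real levels are interposed: the integrals of \<open>h\<close> exceed
    \<open>b'\<close>, the weighted integrals then exceed the smaller \<open>b\<close>.\<close>
  obtain b' where b': "ereal b < ereal b'" "ereal b' < I" using ereal_dense2[OF b(2)] by blast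
  have "eventually (\<lambda>T. integral {0..T} h > b') at_top"
    using order_tendstoD(1)[OF lim b'(2)] by simp
  from eventually_weighted_integral_gt[OF h p R this, of b] b'
  have "eventually (\<lambda>n. integral {0..R * real n powr (1 / p)}
     (\<lambda>u. trunc_weight p (real n) ((u / R) powr p) * exp ((u / R) powr p / p) * h u) > b)
     sequentially" by simp
  then show "eventually (\<lambda>n. a < ereal (integral {0..R * real n powr (1 / p)}
     (\<lambda>u. trunc_weight p (real n) ((u / R) powr p) * exp ((u / R) powr p / p) * h u)))
     sequentially"
    using b(1) by (auto elim!: eventually_mono intro: less_trans)
next
  fix a assume "I < a"
  then obtain b where b: "I < ereal b" "ereal b < a" using ereal_dense2 by blast
  obtain b' where b': "I < ereal b'" "ereal b' < ereal b" using ereal_dense2[OF b(1)] by blast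
  have "eventually (\<lambda>T. integral {0..T} (\<lambda>u. - h u) > - b') at_top"
    using order_tendstoD(2)[OF lim b'(1)] by simp
  from eventually_weighted_integral_gt[OF continuous_on_minus[OF h] p R this, of "- b"] b'
  have "eventually (\<lambda>n. integral {0..R * real n powr (1 / p)}
     (\<lambda>u. trunc_weight p (real n) ((u / R) powr p) * exp ((u / R) powr p / p) * h u) < b)
     sequentially" by simp
  then show "eventually (\<lambda>n. ereal (integral {0..R * real n powr (1 / p)}
     (\<lambda>u. trunc_weight p (real n) ((u / R) powr p) * exp ((u / R) powr p / p) * h u)) < a)
     sequentially"
    using b(2) by (auto elim!: eventually_mono intro: less_trans[of _ "ereal b"])
qed

section \<open>Folding the line onto the half-line\<close>

lemma set_integral_symmetric_interval:
  fixes f :: "real \<Rightarrow> real"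
  assumes f: "continuous_on UNIV f" and "T \<ge> 0"
  shows "(LINT x:{-T..T}|lborel. f x) = integral {0..T} (\<lambda>x. f x + f (- x))"
proof -
  have int: "f integrable_on {a..b}" "(\<lambda>x. f (- x)) integrable_on {a..b}" for a b
    by (intro integrable_continuous_real continuous_on_subset[OF f] subset_UNIV
        continuous_on_compose2[OF f] continuous_intros)+
  have "(LINT x:{-T..T}|lborel. f x) = integral {-T..T} f"
    by (intro set_borel_integral_eq_integral borel_integrable_atLeastAtMost'
        continuous_on_subset[OF f]) auto
  also have "\<dots> = integral {-T..0} f + integral {0..T} f"
    using \<open>T \<ge> 0\<close> int by (intro Henstock_Kurzweil_Integration.integral_combine[symmetric]) auto
  also have "integral {-T..0} f = integral {0..T} (\<lambda>x. f (- x))"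
    using Henstock_Kurzweil_Integration.integral_reflect_real[of T 0 "\<lambda>x. f (- x)"] by simp
  finally show ?thesis
    using int by (simp add: Henstock_Kurzweil_Integration.integral_add)
qed

text \<open>Folding replaces \<open>G u\<close> by \<open>G u + G (- u)\<close>. The function
  \<open>h\<close> is the folded integrand with the limit weight, to which the Abelian theorem
  applies; the tilt cancels the exponential in \<open>h\<close> and restores
  \<open>trunc_weight\<close>.\<close>

lemma trunc_weight_integral_tendsto:
  fixes G :: "real \<Rightarrow> real"
  assumes G: "continuous_on UNIV G" and p: "p > 0" and R: "R > 0"
    and lim: "has_line_integral (\<lambda>u. G u * exp (- ((\<bar>u\<bar> / R) powr p / p))) I"
  shows "(\<lambda>n. ereal (LINT u|lborel. G u * trunc_weight p (real n) ((\<bar>u\<bar> / R) powr p)))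
     \<longlonglongrightarrow> I"
proof -
  define h where "h u = (G u + G (- u)) * exp (- ((u / R) powr p / p))" for u
  have cont: "continuous_on A (\<lambda>u. (\<bar>u\<bar> / R) powr p)" for A
    using p R by (intro continuous_on_powr' continuous_intros) auto
  have "continuous_on {0..} h"
    unfolding h_def using p R
    by (intro continuous_intros continuous_on_powr' continuous_on_subset[OF G]
         continuous_on_compose2[OF G]) auto
  moreover have "((\<lambda>T. ereal (integral {0..T} h)) \<longlongrightarrow> I) at_top"
  proof (rule Lim_transform_eventually[OF lim[unfolded has_line_integral_def]])
    show "eventually (\<lambda>T. ereal (LINT u:{-T..T}|lborel. G u * exp (- ((\<bar>u\<bar> / R) powr p / p))) =
        ereal (integral {0..T} h)) at_top"
      using eventually_ge_at_top[of 0]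
    proof eventually_elim
      case (elim T)
      have "continuous_on UNIV (\<lambda>u. G u * exp (- ((\<bar>u\<bar> / R) powr p / p)))"
        using p by (intro continuous_intros G cont) auto
      from set_integral_symmetric_interval[OF this elim] show ?case
        by (auto intro!: Henstock_Kurzweil_Integration.integral_cong
            simp: h_def algebra_simps)
    qed
  qed
  ultimately have "(\<lambda>n. ereal (integral {0..R * real n powr (1 / p)}
     (\<lambda>u. trunc_weight p (real n) ((u / R) powr p) * exp ((u / R) powr p / p) * h u)))
     \<longlonglongrightarrow> I" using p R by (intro weighted_integral_tendsto)
  then show ?thesis
  proof (rule Lim_transform_eventually)
    show "eventually (\<lambda>n. ereal (integral {0..R * real n powr (1 / p)}
       (\<lambda>u. trunc_weight p (real n) ((u / R) powr p) * exp ((u / R) powr p / p) * h u)) =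
       ereal (LINT u|lborel. G u * trunc_weight p (real n) ((\<bar>u\<bar> / R) powr p))) sequentially"
      using eventually_ge_at_top[of 2]
    proof eventually_elim
      case (elim n)
      define B where "B = R * real n powr (1 / p)"
      have B: "B \<ge> 0" using R by (simp add: B_def)
      have Bp: "(B / R) powr p = real n" using R p elim by (simp add: B_def powr_powr)
      \<comment> \<open>Outside \<open>[-B, B]\<close> one has \<open>z \<ge> n\<close>, so the
        integral over the line reduces to a compact interval.\<close>
      have "trunc_weight p (real n) ((\<bar>u\<bar> / R) powr p) = 0" if "u \<notin> {-B..B}" for u
      proof (rule trunc_weight_eq_0)
        have "(B / R) powr p \<le> (\<bar>u\<bar> / R) powr p"
          using that B R p by (intro powr_mono2 divide_right_mono) auto
        then show "real n \<le> (\<bar>u\<bar> / R) powr p" by (simp add: Bp)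
      qed (use elim in simp)
      then have "(LINT u|lborel. G u * trunc_weight p (real n) ((\<bar>u\<bar> / R) powr p)) =
        (LINT u:{-B..B}|lborel. G u * trunc_weight p (real n) ((\<bar>u\<bar> / R) powr p))"
        unfolding set_lebesgue_integral_def
        by (intro Bochner_Integration.integral_cong) (auto simp: indicator_def)
      also have "\<dots> = integral {0..B} (\<lambda>u. G u * trunc_weight p (real n) ((\<bar>u\<bar> / R) powr p) +
          G (- u) * trunc_weight p (real n) ((\<bar>- u\<bar> / R) powr p))"
        using elim p B
        by (intro set_integral_symmetric_interval continuous_on_mult G
            continuous_on_trunc_weight cont) auto
      also have "\<dots> = integral {0..B} (\<lambda>u. trunc_weight p (real n) ((u / R) powr p) *
          exp ((u / R) powr p / p) * h u)"
        by (intro Henstock_Kurzweil_Integration.integral_cong)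
           (auto simp: h_def exp_minus field_simps)
      finally show ?case by (simp add: B_def)
    qed
  qed
qed

subsection \<open>Averages over the discretized ball\<close>

text \<open>Block \<open>j\<close> consists of \<open>s j * n\<close> intervals of width
  \<open>r j / n\<close>, with total length \<open>s j * r j\<close>. \<open>Q\<close> is arbitrary
  because the mean of a function of \<open>x k\<close> over the ball depends on \<open>k\<close>
  only through the width.\<close>

lemma sum_mesh_partition:
  fixes Q :: "real \<Rightarrow> real"
  assumes mp: "mesh_parameters m s r" and part: "mesh_partition m s r t" and n: "n \<in> mesh_sizes m s"
  shows "(\<Sum>k=1..n. (t n k - t n (k - 1)) * Q (t n k - t n (k - 1))) =
         (\<Sum>j=1..m. s j * r j * Q (r j / real n))"
proof -
  \<comment> \<open>The index of the last interval of block \<open>J\<close>; for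
    \<open>J \<le> m\<close> the rounding is exact, since all \<open>s i * n\<close> are
    integers.\<close>
  define a where "a J = nat \<lfloor>(\<Sum>i\<in>{1..J}. s i) * real n\<rfloor>" for J
  define f where "f k = (t n k - t n (k - 1)) * Q (t n k - t n (k - 1))" for k
  have n1: "n \<ge> 1" and sn: "\<And>j. j \<in> {1..m} \<Longrightarrow> s j * real n \<in> \<int>"
    using n by (auto simp: mesh_sizes_def)
  have sp: "\<And>j. j \<in> {1..m} \<Longrightarrow> s j > 0" and s1: "(\<Sum>j=1..m. s j) = 1"
    using mp by (auto simp: mesh_parameters_def)
  have a: "real (a J) = (\<Sum>i\<in>{1..J}. s i) * real n" if "J \<le> m" for J
  proof -
    have "(\<Sum>i\<in>{1..J}. s i) * real n \<in> \<int>"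
      unfolding sum_distrib_right using that sn by (intro Ints_sum) auto
    moreover have "(\<Sum>i\<in>{1..J}. s i) * real n \<ge> 0"
      using that sp by (intro mult_nonneg_nonneg sum_nonneg) (auto intro: less_imp_le)
    ultimately show ?thesis unfolding a_def by (auto elim!: Ints_cases)
  qed
  have "sum f {1..a J} = (\<Sum>j=1..J. s j * r j * Q (r j / real n))" if "J \<le> m" for J
    using that
  proof (induction J)
    case 0
    then show ?case using a[of 0] by simp
  next
    case (Suc J)
    have diff: "real (a (Suc J)) = real (a J) + s (Suc J) * real n"
      using a[of J] a[of "Suc J"] Suc.prems by (simp add: algebra_simps)
    have le: "a J \<le> a (Suc J)"
    proof -
      have "s (Suc J) * real n \<ge> 0" using sp[of "Suc J"] Suc.prems by simp
      then show ?thesis using diff by linarith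
    qed
    have "f k = r (Suc J) / real n * Q (r (Suc J) / real n)" if "k \<in> {a J<..a (Suc J)}" for k
    proof -
      have "(\<Sum>i\<in>{1..<Suc J}. s i) * real n + 1 \<le> real k"
        using that a[of J] Suc.prems unfolding atLeastLessThanSuc_atLeastAtMost by simp
      moreover have "real k \<le> (\<Sum>i\<in>{1..Suc J}. s i) * real n"
        using that a[of "Suc J"] Suc.prems by simp
      ultimately have "t n k - t n (k - 1) = r (Suc J) / real n"
        using part n Suc.prems unfolding mesh_partition_def by fastforce
      then show ?thesis by (simp add: f_def)
    qed
    then have "sum f {a J<..a (Suc J)} =
       real (a (Suc J) - a J) * (r (Suc J) / real n * Q (r (Suc J) / real n))"
      by simp
    also have "\<dots> = s (Suc J) * r (Suc J) * Q (r (Suc J) / real n)"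
      using diff le n1 by (simp add: of_nat_diff)
    moreover have "{1..a (Suc J)} = {1..a J} \<union> {a J<..a (Suc J)}" using le by auto
    then have "sum f {1..a (Suc J)} = sum f {1..a J} + sum f {a J<..a (Suc J)}"
      by (simp add: sum.union_disjoint ivl_disj_int)
    ultimately show ?case using Suc by simp
  qed
  from this[of m] show ?thesis using a[of m] s1 by (simp add: f_def)
qed

text \<open>Substituting \<open>u = c * v\<close> with \<open>c powr p = 1 / r\<close> turns the
  weight \<open>r / n\<close> into \<open>1 / n\<close>. All coordinates then share one weight
  function, and apart from a constant factor the mesh survives only in the argument of
  \<open>g\<close>.\<close>

lemma integral_rescaled_weight:
  fixes g :: "real \<Rightarrow> real"
  assumes "r > 0" "n > 0" "R > 0" "p > 0"
  shows "(LINT u|lborel. g u * max 0 (R powr p - r / n * \<bar>u\<bar> powr p) powr ((n - 1) / p)) =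
    r powr (- (1 / p)) * (R powr p) powr ((n - 1) / p) *
      (LINT v|lborel. g (r powr (- (1 / p)) * v) * trunc_weight p n ((\<bar>v\<bar> / R) powr p))"
proof -
  define c where "c = r powr (- (1 / p))"
  have c: "c > 0" using assms by (simp add: c_def)
  have cp: "c powr p = 1 / r" using assms by (simp add: c_def powr_powr powr_neg_one)
  have "(LINT u|lborel. g u * max 0 (R powr p - r / n * \<bar>u\<bar> powr p) powr ((n - 1) / p)) =
     \<bar>c\<bar> *\<^sub>R (LINT v|lborel. g (0 + c * v) *
        max 0 (R powr p - r / n * \<bar>0 + c * v\<bar> powr p) powr ((n - 1) / p))"
    using c by (intro lborel_integral_real_affine) auto
  also have "(\<lambda>v. g (0 + c * v) *
        max 0 (R powr p - r / n * \<bar>0 + c * v\<bar> powr p) powr ((n - 1) / p)) =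
     (\<lambda>v. (R powr p) powr ((n - 1) / p) *
        (g (c * v) * trunc_weight p n ((\<bar>v\<bar> / R) powr p)))"
  proof
    fix v :: real
    have "\<bar>c * v\<bar> powr p = \<bar>v\<bar> powr p / r"
      using c by (simp add: abs_mult powr_mult cp)
    moreover have "(\<bar>v\<bar> / R) powr p = \<bar>v\<bar> powr p / R powr p"
      using assms by (simp add: powr_divide)
    ultimately have "R powr p - r / n * \<bar>0 + c * v\<bar> powr p =
        R powr p * (1 - (\<bar>v\<bar> / R) powr p / n)"
      using assms by (simp add: field_simps)
    then have "max 0 (R powr p - r / n * \<bar>0 + c * v\<bar> powr p) =
        R powr p * max 0 (1 - (\<bar>v\<bar> / R) powr p / n)"
      by (simp add: max_mult_distrib_left)
    then show "g (0 + c * v) *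
        max 0 (R powr p - r / n * \<bar>0 + c * v\<bar> powr p) powr ((n - 1) / p) =
       (R powr p) powr ((n - 1) / p) * (g (c * v) * trunc_weight p n ((\<bar>v\<bar> / R) powr p))"
      by (simp add: powr_mult trunc_weight_def)
  qed
  finally show ?thesis using c by (simp add: c_def mult.assoc)
qed

lemma integrable_powr_weight:
  fixes g :: "real \<Rightarrow> real"
  assumes g: "continuous_on UNIV g" and "w > 0" "p > 0" "a > 0" "c > 0"
  shows "integrable lborel (\<lambda>u. g u * max 0 (c - w * \<bar>u\<bar> powr p) powr a)" (is "integrable _ ?f")
proof -
  \<comment> \<open>The weight vanishes for \<open>\<bar>u\<bar> \<ge> B\<close>, so the integrand
    is continuous with compact support.\<close>
  define B where "B = (c / w) powr (1 / p)"
  have B: "B \<ge> 0" "B powr p = c / w" using assms by (auto simp: B_def powr_powr)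
  have *: "indicator {-B..B} u *\<^sub>R ?f u = ?f u" for u
  proof (cases "u \<in> {-B..B}")
    case False
    then have "B powr p \<le> \<bar>u\<bar> powr p" using assms B by (intro powr_mono2) auto
    then have "max 0 (c - w * \<bar>u\<bar> powr p) = 0" using assms by (simp add: B max_def field_simps)
    then show ?thesis by simp
  qed simp
  have "integrable lborel (\<lambda>u. indicator {-B..B} u *\<^sub>R ?f u)"
    using assms
    by (intro borel_integrable_compact continuous_intros continuous_on_powr'
        continuous_on_subset[OF g]) auto
  then show ?thesis unfolding * .
qed

text \<open>The mean of \<open>g (x k)\<close> over the ball is \<open>Q (w k)\<close>, in which all
  volume constants have cancelled; summing over the mesh groups these means by blocks. With
  \<open>n \<ge> 2\<close> the exponent \<open>(n - 1) / p\<close> is positive, so the weights are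
  continuous and the integrals exist.\<close>

lemma disc_average_eq:
  fixes g :: "real \<Rightarrow> real"
  assumes mp: "mesh_parameters m s r" and part: "mesh_partition m s r t"
    and n: "n \<in> mesh_sizes m s" "n \<ge> 2" and g: "continuous_on UNIV g" and "R > 0" "p > 0"
  shows "disc_average g (\<lambda>x. \<bar>x\<bar> powr p) (R powr p) n (t n) =
    (LINT u|lborel. (\<Sum>j=1..m. s j * r j * g (r j powr (- (1 / p)) * u)) *
        trunc_weight p (real n) ((\<bar>u\<bar> / R) powr p)) /
    (LINT u|lborel. trunc_weight p (real n) ((\<bar>u\<bar> / R) powr p))"
proof -
  define w where "w k = t n k - t n (k - 1)" for k
  define M where "M = (\<Pi>\<^sub>M k\<in>{1..n}. (lborel :: real measure))"
  define S where "S = weighted_ball p {1..n} w (R powr p)"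
  define N where "N f = (LINT u|lborel. f u * trunc_weight p (real n) ((\<bar>u\<bar> / R) powr p))"
    for f :: "real \<Rightarrow> real"
  \<comment> \<open>For \<open>\<delta> = r j / n\<close> the factor \<open>n * \<delta>\<close>
    recovers \<open>r j\<close>.\<close>
  define Q where "Q \<delta> = N (\<lambda>u. g ((real n * \<delta>) powr (- (1 / p)) * u)) / N (\<lambda>_. 1)" for \<delta>
  have w: "\<forall>k\<in>{1..n}. w k > 0"
    using part n by (auto simp: mesh_partition_def w_def)
  have ball: "disc_ball (\<lambda>x. \<bar>x\<bar> powr p) (R powr p) n (t n) = S"
    by (simp add: S_def disc_ball_def disc_functional_def weighted_ball_def w_def mult.commute)
  have gm: "g \<in> borel_measurable borel" using g by (rule borel_measurable_continuous_onI)
  have *: "set_integrable M S (\<lambda>x. g (x k))"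
    "(LINT x:S|M. g (x k)) / (LINT x:S|M. 1) = Q (w k)" if k: "k \<in> {1..n}" for k
  proof -
    obtain K where K: "K > 0" "\<forall>g\<in>borel_measurable borel.
     (LINT x:S|M. g (x k)) =
       K * (LINT u|lborel. g u * max 0 (R powr p - w k * \<bar>u\<bar> powr p) powr ((real n - 1) / p)) \<and>
     (integrable lborel (\<lambda>u. g u * max 0 (R powr p - w k * \<bar>u\<bar> powr p) powr ((real n - 1) / p)) \<longrightarrow>
       set_integrable M S (\<lambda>x. g (x k)))"
      using set_integral_weighted_ball[OF _ k w \<open>p > 0\<close>, of "R powr p"]
      unfolding M_def S_def by auto
    have "integrable lborel (\<lambda>u. g u * max 0 (R powr p - w k * \<bar>u\<bar> powr p) powr ((real n - 1) / p))"
      using n \<open>R > 0\<close> \<open>p > 0\<close> w k by (intro integrable_powr_weight g) auto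
    then show "set_integrable M S (\<lambda>x. g (x k))" using K(2) gm by blast
    define C where "C = K * ((real n * w k) powr (- (1 / p)) * (R powr p) powr ((real n - 1) / p))"
    have "(LINT x:S|M. f (x k)) = C * N (\<lambda>u. f ((real n * w k) powr (- (1 / p)) * u))"
      if "f \<in> borel_measurable borel" for f
      using K(2) that integral_rescaled_weight[of "real n * w k" "real n" R p f]
        n w k \<open>R > 0\<close> \<open>p > 0\<close>
      by (simp add: C_def N_def mult_ac)
    from this[OF gm] this[of "\<lambda>_. 1"]
    have "(LINT x:S|M. g (x k)) / (LINT x:S|M. 1) = C * (N (\<lambda>u. g ((real n * w k) powr (- (1 / p)) * u))) /
        (C * N (\<lambda>_. 1))"
      by simp
    moreover have "C \<noteq> 0"
    proof -
      have "n > 0" "w k > 0" using w k n by auto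
      then show ?thesis using K(1) \<open>R > 0\<close> by (simp add: C_def)
    qed
    ultimately show "(LINT x:S|M. g (x k)) / (LINT x:S|M. 1) = Q (w k)"
      by (simp add: Q_def)
  qed
  have "(LINT x:S|M. disc_functional g n (t n) x) =
      (LINT x|M. (\<Sum>k=1..n. w k * (indicator S x *\<^sub>R g (x k))))"
    unfolding set_lebesgue_integral_def disc_functional_def
    by (simp add: w_def sum_distrib_left mult_ac)
  also have "\<dots> = (\<Sum>k=1..n. w k * (LINT x:S|M. g (x k)))"
    unfolding set_lebesgue_integral_def
    using *(1) by (subst Bochner_Integration.integral_sum) (auto simp: set_integrable_def)
  finally have "disc_average g (\<lambda>x. \<bar>x\<bar> powr p) (R powr p) n (t n) =
     (\<Sum>k=1..n. w k * Q (w k))"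
    unfolding disc_average_def ball M_def[symmetric]
    by (simp add: sum_divide_distrib flip: *(2))
  also have "\<dots> = (\<Sum>j=1..m. s j * r j * Q (r j / real n))"
    unfolding w_def by (rule sum_mesh_partition[OF mp part n(1)])
  also have "\<dots> = (\<Sum>j=1..m. s j * r j * N (\<lambda>u. g (r j powr (- (1 / p)) * u))) / N (\<lambda>_. 1)"
    using n by (simp add: Q_def sum_divide_distrib)
  also have "(\<Sum>j=1..m. s j * r j * N (\<lambda>u. g (r j powr (- (1 / p)) * u))) =
     (LINT u|lborel. (\<Sum>j=1..m. s j * r j * (g (r j powr (- (1 / p)) * u) *
        trunc_weight p (real n) ((\<bar>u\<bar> / R) powr p))))"
  proof (subst Bochner_Integration.integral_sum)
    fix j assume "j \<in> {1..m}"
    have "continuous_on UNIV (\<lambda>u. g (r j powr (- (1 / p)) * u))"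
      by (intro continuous_on_compose2[OF g] continuous_intros) auto
    \<comment> \<open>The truncated weight is the power weight of level 1 with
      \<open>w = 1 / (n * R powr p)\<close>.\<close>
    from integrable_powr_weight[OF this, of "1 / (real n * R powr p)" p "(real n - 1) / p" 1]
    show "integrable lborel (\<lambda>u. s j * r j * (g (r j powr (- (1 / p)) * u) *
        trunc_weight p (real n) ((\<bar>u\<bar> / R) powr p)))"
      using n \<open>R > 0\<close> \<open>p > 0\<close> by (simp add: trunc_weight_def powr_divide mult.commute)
  qed (simp add: N_def)
  finally show ?thesis by (simp add: N_def sum_distrib_right mult.assoc)
qed

subsection \<open>The growth conditions\<close>

lemma absolutely_integrable_imp_set_integrable_lborel:
  fixes f :: "real \<Rightarrow> real"
  assumes [measurable]: "f \<in> borel_measurable borel" "A \<in> sets borel"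
    and "f absolutely_integrable_on A"
  shows "set_integrable lborel A f"
  using assms(3) unfolding set_integrable_def
  by (subst (asm) integrable_completion) auto

text \<open>The radial substitution is differentiable on the open half-line; adding the endpoint 0
  changes only a null set.\<close>

lemma set_integral_half_line:
  fixes f :: "real \<Rightarrow> real"
  assumes [measurable]: "f \<in> borel_measurable borel" and f: "f absolutely_integrable_on {0<..}"
  shows "set_integrable lborel {0..} f" "(LINT x:{0..}|lborel. f x) = integral {0<..} f"
proof -
  have int: "set_integrable lborel {0<..} f"
    using f by (intro absolutely_integrable_imp_set_integrable_lborel) auto
  have AE: "AE x in lborel. indicator {0..} x *\<^sub>R f x = indicator {0<..} x *\<^sub>R f x"
    using AE_lborel_singleton[of "0::real"] by eventually_elim (auto simp: indicator_def)
  show "set_integrable lborel {0..} f"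
    using int unfolding set_integrable_def by (subst integrable_cong_AE[OF _ _ AE]) auto
  have "(LINT x:{0..}|lborel. f x) = (LINT x:{0<..}|lborel. f x)"
    unfolding set_lebesgue_integral_def by (rule integral_cong_AE[OF _ _ AE]) auto
  also have "\<dots> = integral {0<..} f"
    using int by (rule set_borel_integral_eq_integral)
  finally show "(LINT x:{0..}|lborel. f x) = integral {0<..} f" .
qed

text \<open>For \<open>T \<ge> 0\<close> the integral over \<open>[-T, T]\<close> is that of
  \<open>f x + f (- x)\<close> over \<open>[0, T]\<close>, so integrability of the even part gives
  convergence, and an odd part of any growth is harmless.\<close>

lemma has_line_integral_even_part:
  fixes f :: "real \<Rightarrow> real"
  assumes f: "continuous_on UNIV f" and int: "set_integrable lborel {0..} (\<lambda>x. f x + f (- x))"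
  shows "has_line_integral f (ereal (LINT x:{0..}|lborel. f x + f (- x)))"
proof -
  define h where "h x = f x + f (- x)" for x
  have "((\<lambda>T. LINT x|lborel. indicator {..T} x *\<^sub>R (indicator {0..} x *\<^sub>R h x)) \<longlongrightarrow>
     (LINT x|lborel. indicator {0..} x *\<^sub>R h x)) at_top"
    using int by (intro tendsto_integral_at_top) (auto simp: set_integrable_def h_def)
  moreover have "eventually (\<lambda>T. (LINT x|lborel. indicator {..T} x *\<^sub>R (indicator {0..} x *\<^sub>R h x)) =
     (LINT x:{-T..T}|lborel. f x)) at_top"
    using eventually_ge_at_top[of 0]
  proof eventually_elim
    case (elim T)
    have "(LINT x|lborel. indicator {..T} x *\<^sub>R (indicator {0..} x *\<^sub>R h x)) =
        (LINT x:{0..T}|lborel. h x)"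
      unfolding set_lebesgue_integral_def
      by (intro Bochner_Integration.integral_cong) (auto simp: indicator_def)
    also have "continuous_on {0..T} h" unfolding h_def
      by (intro continuous_intros continuous_on_subset[OF f] continuous_on_compose2[OF f]) auto
    then have "(LINT x:{0..T}|lborel. h x) = integral {0..T} h"
      by (intro set_borel_integral_eq_integral borel_integrable_atLeastAtMost')
    finally show ?case using set_integral_symmetric_interval[OF f elim] by (simp add: h_def[abs_def])
  qed
  ultimately show ?thesis
    unfolding has_line_integral_def set_lebesgue_integral_def h_def
    by (auto simp: set_lebesgue_integral_def elim: Lim_transform_eventually)
qed

section \<open>The radial substitution and the normalizing integral\<close>

lemma radial_map:
  fixes R p c :: real
  assumes "R > 0" "p > 0" "c > 0" "b \<ge> 0"
  shows "inj_on (\<lambda>y. R * (c * y) powr (1 / p)) {b<..}"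
    and "(\<lambda>y. R * (c * y) powr (1 / p)) ` {b<..} = {R * (c * b) powr (1 / p)<..}"
proof -
  \<comment> \<open>The inverse map is \<open>u \<mapsto> (u / R) powr p / c\<close>. The case
    \<open>c = p\<close> leads to the Gamma integral, the case \<open>c = 1\<close> to the variable
    of the second growth condition.\<close>
  have inv: "((R * (c * y) powr (1 / p)) / R) powr p / c = y" if "y \<ge> 0" for y
    using that assms by (simp add: powr_powr)
  show "inj_on (\<lambda>y. R * (c * y) powr (1 / p)) {b<..}"
  proof (rule inj_onI)
    fix x y assume "x \<in> {b<..}" "y \<in> {b<..}" "R * (c * x) powr (1 / p) = R * (c * y) powr (1 / p)"
    then show "x = y" using inv[of x] inv[of y] assms by simp
  qed
  show "(\<lambda>y. R * (c * y) powr (1 / p)) ` {b<..} = {R * (c * b) powr (1 / p)<..}"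
  proof (intro set_eqI iffI)
    fix u assume "u \<in> (\<lambda>y. R * (c * y) powr (1 / p)) ` {b<..}"
    then show "u \<in> {R * (c * b) powr (1 / p)<..}"
      using assms by (auto intro!: powr_less_mono2)
  next
    fix u assume u: "u \<in> {R * (c * b) powr (1 / p)<..}"
    have u0: "u > 0" using u assms by (auto intro: le_less_trans[rotated])
    define y where "y = (u / R) powr p / c"
    have "R * (c * y) powr (1 / p) = u" using u0 assms by (simp add: y_def powr_powr)
    moreover have "y > b"
    proof -
      have "(c * b) powr (1 / p) < u / R" using u assms by (simp add: field_simps)
      then have "((c * b) powr (1 / p)) powr p < (u / R) powr p"
        using assms by (intro powr_less_mono2) auto
      then show ?thesis using assms by (simp add: y_def powr_powr field_simps)
    qed
    ultimately show "u \<in> (\<lambda>y. R * (c * y) powr (1 / p)) ` {b<..}" by force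
  qed
qed

lemma radial_has_derivative:
  fixes R p c :: real
  assumes "p > 0" "c > 0" "y > 0"
  shows "((\<lambda>y. R * (c * y) powr (1 / p)) has_field_derivative
      R * c powr (1 / p) / p * y powr (1 / p - 1)) (at y within S)"
proof -
  have "((\<lambda>y. R * (c * y) powr (1 / p)) has_field_derivative
      R * ((1 / p) * (c * y) powr (1 / p - 1) * c)) (at y)"
    using assms by (auto intro!: derivative_eq_intros)
  also have "R * ((1 / p) * (c * y) powr (1 / p - 1) * c) =
     R * c powr (1 / p) / p * y powr (1 / p - 1)"
    using assms by (simp add: powr_mult powr_diff)
  finally show ?thesis by (rule has_field_derivative_at_within)
qed

text \<open>With \<open>u = R * (p * y) powr (1 / p)\<close> the exponent becomes \<open>- y\<close>
  and the Jacobian a multiple of \<open>y powr (1 / p - 1)\<close>, so each half-line contributes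
  Euler's integral for \<open>Gamma (1 / p)\<close>. The value is the limit of the denominators of
  the averages.\<close>

lemma has_line_integral_gaussian:
  fixes R p :: real
  assumes "R > 0" "p > 0"
  shows "has_line_integral (\<lambda>u. exp (- ((\<bar>u\<bar> / R) powr p / p)))
     (ereal (2 * R * Gamma (1 / p) * p powr (1 / p - 1)))"
proof -
  define f where "f u = exp (- ((\<bar>u\<bar> / R) powr p / p))" for u
  define h where "h u = f u + f (- u)" for u
  define C where "C = R * p powr (1 / p) / p"
  have f: "continuous_on UNIV f"
    unfolding f_def using assms by (intro continuous_intros continuous_on_powr') auto
  have [measurable]: "f \<in> borel_measurable borel"
    using f by (rule borel_measurable_continuous_onI)
  have [measurable]: "h \<in> borel_measurable borel" unfolding h_def by measurable
  have Gamma: "((\<lambda>y. y powr (1 / p - 1) / exp y) has_integral Gamma (1 / p)) {0<..}"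
  proof -
    have "negligible ({0..} - {0<..} \<union> ({0<..} - {0..}) :: real set)"
      by (rule negligible_subset[of "{0}"]) auto
    then show ?thesis
      using Gamma_integral_real[of "1 / p"] assms
      by (subst has_integral_spike_set_eq[of _ "{0..}"]) (auto intro: negligible_subset)
  qed
  have eq: "\<bar>C * y powr (1 / p - 1)\<bar> * h (R * (p * y) powr (1 / p)) =
      2 * C * (y powr (1 / p - 1) / exp y)" if "y \<in> {0<..}" for y
    using that assms by (simp add: h_def f_def C_def abs_mult powr_powr exp_minus field_simps)
  have "((\<lambda>y. \<bar>C * y powr (1 / p - 1)\<bar> * h (R * (p * y) powr (1 / p))) has_integral
      2 * C * Gamma (1 / p)) {0<..}"
    using has_integral_mult_right[OF Gamma, of "2 * C"] by (rule has_integral_eq[rotated]) (simp only: eq)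
  \<comment> \<open>Nonnegativity upgrades integrability to absolute integrability, as the change of
    variables demands.\<close>
  moreover have "\<bar>C * y powr (1 / p - 1)\<bar> * h (R * (p * y) powr (1 / p)) \<ge> 0" for y
    by (simp add: h_def f_def)
  ultimately have "(\<lambda>y. \<bar>C * y powr (1 / p - 1)\<bar> * h (R * (p * y) powr (1 / p)))
      absolutely_integrable_on {0<..} \<and>
      integral {0<..} (\<lambda>y. \<bar>C * y powr (1 / p - 1)\<bar> * h (R * (p * y) powr (1 / p))) =
        2 * C * Gamma (1 / p)"
    by (auto simp: has_integral_iff intro!: nonnegative_absolutely_integrable_1)
  also have "?this \<longleftrightarrow> h absolutely_integrable_on (\<lambda>y. R * (p * y) powr (1 / p)) ` {0<..} \<and>
      integral ((\<lambda>y. R * (p * y) powr (1 / p)) ` {0<..}) h = 2 * C * Gamma (1 / p)"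
  proof (rule has_absolute_integral_change_of_variables_1')
    show "((\<lambda>y. R * (p * y) powr (1 / p)) has_field_derivative C * y powr (1 / p - 1))
        (at y within {0<..})" if "y \<in> {0<..}" for y
      using radial_has_derivative[of p p y R] that assms by (simp add: C_def)
  qed (use radial_map(1)[of R p p 0] assms in auto)
  also have "(\<lambda>y. R * (p * y) powr (1 / p)) ` {0<..} = {0<..}"
    using radial_map(2)[of R p p 0] assms by simp
  finally have "h absolutely_integrable_on {0<..}" and I: "integral {0<..} h = 2 * C * Gamma (1 / p)"
    by auto
  note * = set_integral_half_line[OF _ this(1)]
  have "has_line_integral f (ereal (LINT x:{0..}|lborel. f x + f (- x)))"
    using * f by (intro has_line_integral_even_part) (auto simp: h_def[abs_def])
  also have "(LINT x:{0..}|lborel. f x + f (- x)) = 2 * R * Gamma (1 / p) * p powr (1 / p - 1)"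
    using *(2) I assms by (simp add: h_def C_def powr_diff)
  finally show ?thesis by (simp add: f_def)
qed

text \<open>On \<open>[0, R]\<close> continuity suffices. For \<open>u > R\<close> put
  \<open>u = R * x powr (1 / p)\<close>: then \<open>x > 1\<close>, and the Jacobian power
  \<open>x powr (1 / p - 1)\<close> is dominated by the \<open>x powr (1 / p + 1)\<close> of the
  condition.\<close>

lemma condition_H2_imp_set_integrable:
  fixes g :: "real \<Rightarrow> real"
  assumes "R > 0" "p > 0" and g: "continuous_on UNIV g" and H2: "condition_H2 p R g"
  shows "set_integrable lborel {0..} (\<lambda>u. (g u + g (- u)) * exp (- ((u / R) powr p / p)))"
proof -
  define h where "h u = (g u + g (- u)) * exp (- ((u / R) powr p / p))" for u
  define C where "C = R / p"
  have gm [measurable]: "g \<in> borel_measurable borel"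
    using g by (rule borel_measurable_continuous_onI)
  have [measurable]: "h \<in> borel_measurable borel" unfolding h_def by measurable
  have cont: "continuous_on {0..} h"
    unfolding h_def using assms
    by (intro continuous_intros continuous_on_powr' continuous_on_subset[OF g]
        continuous_on_compose2[OF g]) auto
  have head: "set_integrable lborel {0..R} h"
    by (intro borel_integrable_atLeastAtMost' continuous_on_subset[OF cont]) auto
  have "set_integrable lborel {1<..}
     (\<lambda>x. x powr (1/p + 1) * \<bar>g (R * x powr (1/p)) + g (- R * x powr (1/p))\<bar> * exp (- x / p))"
    by (rule set_integrable_subset[OF H2[unfolded condition_H2_def]]) auto
  then have "set_integrable lborel {1<..}
     (\<lambda>x. C * (x powr (1/p + 1) * \<bar>g (R * x powr (1/p)) + g (- R * x powr (1/p))\<bar> * exp (- x / p)))"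
    by simp
  then have "set_integrable lborel {1<..}
     (\<lambda>x. \<bar>C * x powr (1 / p - 1)\<bar> * h (R * (1 * x) powr (1 / p)))"
  proof (rule set_integrable_bound)
    show "set_borel_measurable lborel {1<..}
      (\<lambda>x. \<bar>C * x powr (1 / p - 1)\<bar> * h (R * (1 * x) powr (1 / p)))"
      unfolding set_borel_measurable_def by measurable
    show "AE x in lborel. x \<in> {1<..} \<longrightarrow>
       norm (\<bar>C * x powr (1 / p - 1)\<bar> * h (R * (1 * x) powr (1 / p))) \<le>
       norm (C * (x powr (1/p + 1) * \<bar>g (R * x powr (1/p)) + g (- R * x powr (1/p))\<bar> * exp (- x / p)))"
    proof (intro AE_I2 impI)
      fix x :: real assume x: "x \<in> {1<..}"
      have "x powr (1 / p - 1) \<le> x powr (1 / p + 1)" using x by (intro powr_mono) auto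
      then have "C * x powr (1 / p - 1) * (\<bar>g (R * x powr (1/p)) + g (- R * x powr (1/p))\<bar> * exp (- x / p))
        \<le> C * x powr (1 / p + 1) * (\<bar>g (R * x powr (1/p)) + g (- R * x powr (1/p))\<bar> * exp (- x / p))"
        using assms by (intro mult_right_mono mult_left_mono) (auto simp: C_def)
      then show "norm (\<bar>C * x powr (1 / p - 1)\<bar> * h (R * (1 * x) powr (1 / p))) \<le>
       norm (C * (x powr (1/p + 1) * \<bar>g (R * x powr (1/p)) + g (- R * x powr (1/p))\<bar> * exp (- x / p)))"
        using x assms by (simp add: h_def abs_mult powr_powr C_def mult_ac)
    qed
  qed
  then have "(\<lambda>x. \<bar>C * x powr (1 / p - 1)\<bar> * h (R * (1 * x) powr (1 / p)))
     absolutely_integrable_on {1<..}"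
    unfolding set_integrable_def by (subst integrable_completion) auto
  also have "?this \<longleftrightarrow> h absolutely_integrable_on (\<lambda>x. R * (1 * x) powr (1 / p)) ` {1<..}"
  proof (rule absolutely_integrable_change_of_variables_1'[symmetric])
    show "((\<lambda>x. R * (1 * x) powr (1 / p)) has_field_derivative C * x powr (1 / p - 1))
        (at x within {1<..})" if "x \<in> {1<..}" for x
      using radial_has_derivative[of p 1 x R] that assms by (simp add: C_def)
  qed (use radial_map(1)[of R p 1 1] assms in auto)
  also have "(\<lambda>x. R * (1 * x) powr (1 / p)) ` {1<..} = {R<..}"
    using radial_map(2)[of R p 1 1] assms by simp
  finally have "set_integrable lborel {R<..} h"
    by (intro absolutely_integrable_imp_set_integrable_lborel) auto
  from set_integrable_Un[OF head this]
  have "set_integrable lborel ({0..R} \<union> {R<..}) h" by simp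
  also have "{0..R} \<union> {R<..} = {0..}" using assms by auto
  finally show ?thesis by (simp add: h_def)
qed

section \<open>Polynomial growth under the first condition\<close>

lemma one_plus_power_le_exp:
  fixes b :: real
  assumes "b > 0"
  shows "\<exists>C\<ge>0. \<forall>y\<ge>0. (1 + y) ^ N \<le> C * exp (b * y)"
proof (cases "N = 0")
  case True
  then show ?thesis using assms by (intro exI[of _ 1]) auto
next
  case False
  \<comment> \<open>Since \<open>c \<ge> 1\<close> and \<open>c * b \<ge> N\<close>, one gets
    \<open>1 + y \<le> c * (1 + b * y / N)\<close>, and the \<open>N\<close>-th power of the bracket
    is at most \<open>exp (b * y)\<close>.\<close>
  define c where "c = max 1 (real N / b)"
  show ?thesis
  proof (intro exI[of _ "c ^ N"] conjI allI impI)
    show "c ^ N \<ge> 0" by (simp add: c_def)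
    fix y :: real assume y: "y \<ge> 0"
    have ge: "- real N \<le> b * y" using mult_nonneg_nonneg[of b y] y assms by linarith
    have "y * 1 \<le> y * (c * b / real N)"
      using y assms False by (intro mult_left_mono) (auto simp: c_def max_def field_simps)
    moreover have "1 \<le> c" by (simp add: c_def)
    ultimately have "1 + y \<le> c * (1 + b * y / real N)" by (simp add: algebra_simps)
    then have "(1 + y) ^ N \<le> (c * (1 + b * y / real N)) ^ N"
      using y by (intro power_mono) auto
    also have "\<dots> = c ^ N * (1 + b * y / real N) ^ N" by (simp add: power_mult_distrib)
    also have "\<dots> \<le> c ^ N * exp (b * y)"
      using ge y assms False
      by (intro mult_left_mono exp_ge_one_plus_x_over_n_power_n) (auto simp: c_def)
    finally show "(1 + y) ^ N \<le> c ^ N * exp (b * y)" .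
  qed
qed

text \<open>Descending induction from the bounded \<open>k\<close>-th derivative: each use of the
  mean value inequality on \<open>[0, x]\<close> costs one factor \<open>1 + x\<close>.\<close>

lemma Ck_derivatives_on_polynomial_bound:
  assumes d: "Ck_derivatives_on k {0..} d" and A: "\<And>x. x \<ge> 0 \<Longrightarrow> \<bar>d k x\<bar> \<le> A"
  shows "\<exists>C\<ge>0. \<forall>x\<ge>0. \<bar>d 0 x\<bar> \<le> C * (1 + x) ^ k"
proof -
  have "\<exists>C\<ge>0. \<forall>x\<ge>0. \<bar>d (k - i) x\<bar> \<le> C * (1 + x) ^ i" if "i \<le> k" for i
    using that
  proof (induction i)
    case 0
    have "A \<ge> 0" using A[of 0] by simp
    then show ?case using A by auto
  next
    case (Suc i)
    then obtain C where C: "C \<ge> 0" "\<And>x. x \<ge> 0 \<Longrightarrow> \<bar>d (k - i) x\<bar> \<le> C * (1 + x) ^ i" by auto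
    define l where "l = k - Suc i"
    have l: "k - i = Suc l" "l < k" using Suc.prems by (auto simp: l_def)
    show ?case
    proof (intro exI[of _ "\<bar>d l 0\<bar> + C"] conjI allI impI)
      fix x :: real assume x: "x \<ge> 0"
      have "norm (d l x - d l 0) \<le> C * (1 + x) ^ i * norm (x - 0)"
      proof (rule field_differentiable_bound[where S = "{0..x}" and f' = "d (Suc l)"])
        fix y assume y: "y \<in> {0..x}"
        then have "(d l has_real_derivative d (Suc l) y) (at y within {0..})"
          using d l by (auto simp: Ck_derivatives_on_def)
        then show "(d l has_field_derivative d (Suc l) y) (at y within {0..x})"
          by (rule DERIV_subset) auto
        have "\<bar>d (Suc l) y\<bar> \<le> C * (1 + y) ^ i" using C(2)[of y] y l by simp
        also have "\<dots> \<le> C * (1 + x) ^ i" using C(1) y by (intro mult_left_mono power_mono) auto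
        finally show "norm (d (Suc l) y) \<le> C * (1 + x) ^ i" by simp
      qed (use x in auto)
      then have "\<bar>d l x\<bar> \<le> \<bar>d l 0\<bar> * 1 + C * ((1 + x) ^ i * x)" using x by simp
      also have "\<dots> \<le> \<bar>d l 0\<bar> * (1 + x) ^ Suc i + C * ((1 + x) ^ i * (1 + x))"
        using x C(1) by (intro add_mono mult_left_mono one_le_power) auto
      finally show "\<bar>d (k - Suc i) x\<bar> \<le> (\<bar>d l 0\<bar> + C) * (1 + x) ^ Suc i"
        by (simp add: l_def algebra_simps)
    qed (use C in auto)
  qed
  from this[of k] show ?thesis by simp
qed

text \<open>The second condition is not invariant under rescaling the argument: for
  \<open>\<rho> < 1\<close> the rescaled function may grow too fast for the factor
  \<open>exp (- x / p)\<close>. Under the first condition the even part of \<open>g\<close> at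
  \<open>R * y powr (1/p)\<close> is at most \<open>y powr (1 - 1/p)\<close> times a polynomial in
  \<open>y\<close>, and the exponential wins at every scale.\<close>

lemma condition_H1_imp_scaled_H2:
  fixes g :: "real \<Rightarrow> real"
  assumes "R > 0" "p > 0" "\<rho> > 0" and g: "continuous_on UNIV g" and H1: "condition_H1 p R g"
  shows "condition_H2 p R (\<lambda>x. g (\<rho> powr (- (1 / p)) * x))"
proof -
  obtain k d A where d: "Ck_derivatives_on k {0..} d"
    and d0: "\<And>x. x > 0 \<Longrightarrow> d 0 x = x powr (1/p - 1) * (g (R * x powr (1/p)) + g (- R * x powr (1/p)))"
    and A: "\<And>x. x \<ge> 0 \<Longrightarrow> \<bar>d k x\<bar> \<le> A"
    using H1 unfolding condition_H1_def by blast
  obtain C where C: "C \<ge> 0" "\<And>x. x \<ge> 0 \<Longrightarrow> \<bar>d 0 x\<bar> \<le> C * (1 + x) ^ k"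
    using Ck_derivatives_on_polynomial_bound[OF d A] by blast
  \<comment> \<open>The power \<open>k\<close> comes from the bound on \<open>d 0\<close>, the 2
    from the powers of \<open>y\<close> collected below. With \<open>y = x / \<rho>\<close> the
    exponent is \<open>x / (2 * p)\<close>, half of the available decay.\<close>
  obtain D where D: "D \<ge> 0" "\<And>y. y \<ge> 0 \<Longrightarrow> (1 + y) ^ (k + 2) \<le> D * exp (\<rho> / (2 * p) * y)"
    using one_plus_power_le_exp[of "\<rho> / (2 * p)" "k + 2"] assms by auto
  define M where "M = \<rho> powr (1 / p + 1) * (C * D)"
  define E where "E x = \<bar>g (\<rho> powr (- (1 / p)) * (R * x powr (1/p))) +
      g (\<rho> powr (- (1 / p)) * (- R * x powr (1/p)))\<bar>" for x
  have [measurable]: "g \<in> borel_measurable borel"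
    using g by (rule borel_measurable_continuous_onI)
  have bound: "x powr (1/p + 1) * E x * exp (- x / p) \<le> M * exp (- (1 / (2 * p)) * x)"
    if "x \<ge> 0" for x
  proof (cases "x = 0")
    \<comment> \<open>At \<open>x = 0\<close> the left side is 0 by the convention
      \<open>0 powr a = 0\<close>; the formula for \<open>d 0\<close> covers only positive
      arguments.\<close>
    case True
    then show ?thesis using C D by (simp add: M_def)
  next
    case False
    define y where "y = x / \<rho>"
    have y: "y > 0" "x = \<rho> * y" using False that assms by (auto simp: y_def)
    have "\<rho> powr (- (1 / p)) * x powr (1 / p) = y powr (1 / p)"
      using y assms by (simp add: powr_mult powr_minus)
    then have s: "\<rho> powr (- (1 / p)) * (b * x powr (1 / p)) = b * y powr (1 / p)" for b
      by (metis mult.left_commute)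
    have E: "E x = \<bar>g (R * y powr (1/p)) + g (- R * y powr (1/p))\<bar>"
      unfolding E_def s ..
    have "y powr (1 / p - 1) * E x = \<bar>d 0 y\<bar>"
      unfolding E d0[OF y(1)] by (simp add: abs_mult)
    \<comment> \<open>This factor undoes the \<open>y powr (1 / p - 1)\<close> in
      \<open>d 0\<close>.\<close>
    then have "y powr (1 - 1 / p) * \<bar>d 0 y\<bar> = y powr ((1 - 1 / p) + (1 / p - 1)) * E x"
      unfolding powr_add by (simp add: mult.assoc)
    then have "E x = y powr (1 - 1 / p) * \<bar>d 0 y\<bar>"
      using y by simp
    moreover have "y powr (1 / p + 1) * y powr (1 - 1 / p) = y ^ 2"
      using y by (simp flip: powr_add)
    ultimately have "x powr (1/p + 1) * E x = \<rho> powr (1 / p + 1) * (y ^ 2 * \<bar>d 0 y\<bar>)"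
      using y assms by (simp add: powr_mult)
    also have "\<dots> \<le> \<rho> powr (1 / p + 1) * ((1 + y) ^ 2 * (C * (1 + y) ^ k))"
      using y C assms by (intro mult_left_mono mult_mono power_mono) auto
    also have "\<dots> = \<rho> powr (1 / p + 1) * (C * (1 + y) ^ (k + 2))"
      by (simp add: power_add power2_eq_square mult_ac)
    also have "\<dots> \<le> \<rho> powr (1 / p + 1) * (C * (D * exp (\<rho> / (2 * p) * y)))"
      using y C D(2)[of y] by (intro mult_left_mono) auto
    also have "\<dots> = M * exp (x / (2 * p))" using y by (simp add: M_def mult_ac)
    finally have "x powr (1/p + 1) * E x * exp (- x / p) \<le> M * exp (x / (2 * p)) * exp (- x / p)"
      by (intro mult_right_mono) auto
    also have "\<dots> = M * exp (- (1 / (2 * p)) * x)"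
      using assms by (simp add: mult.assoc field_simps flip: exp_add)
    finally show ?thesis .
  qed
  have "(\<lambda>x. exp (- (1 / (2 * p)) * x)) absolutely_integrable_on {0..}"
    using assms
    by (intro nonnegative_absolutely_integrable_1 integrable_on_exp_minus_to_infinity) auto
  then have "set_integrable lborel {0..} (\<lambda>x. M * exp (- (1 / (2 * p)) * x))"
    by (intro set_integrable_mult_right absolutely_integrable_imp_set_integrable_lborel) auto
  then have "set_integrable lborel {0..} (\<lambda>x. x powr (1/p + 1) * E x * exp (- x / p))"
  proof (rule set_integrable_bound)
    show "set_borel_measurable lborel {0..} (\<lambda>x. x powr (1/p + 1) * E x * exp (- x / p))"
      unfolding set_borel_measurable_def E_def by measurable
    show "AE x in lborel. x \<in> {0..} \<longrightarrow> norm (x powr (1/p + 1) * E x * exp (- x / p)) \<le>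
        norm (M * exp (- (1 / (2 * p)) * x))"
      using bound C D by (intro AE_I2) (auto simp: M_def E_def abs_mult)
  qed
  then show ?thesis by (simp add: condition_H2_def E_def)
qed

subsection \<open>The average value and its dependence on the mesh\<close>

lemma mixed_integrand_eq:
  fixes R p :: real
  assumes "R > 0" "p0 > 0" "q0 > 0" "even p0" "p = real p0 / real q0"
  shows "mixed_integrand g p0 q0 R m s r = (\<lambda>x. (\<Sum>j=1..m. s j * r j * g (r j powr (- (1 / p)) * x)) *
     exp (- ((\<bar>x\<bar> / R) powr p / p)))"
  using assms by (simp add: fun_eq_iff mixed_integrand_def Let_def rat_pow_eq_powr powr_divide mult.commute)

lemma continuous_on_mixture:
  fixes g :: "real \<Rightarrow> real"
  assumes g: "continuous_on UNIV g"
  shows "continuous_on UNIV (\<lambda>x. \<Sum>j=1..m. s j * r j * g (c j * x))"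
  by (intro continuous_intros continuous_on_compose2[OF g]) auto

text \<open>The Abelian theorem covers both numerator and denominator, the latter with constant
  function 1 and the finite positive limit \<open>D\<close>. The limit along all \<open>n\<close>
  restricts to the admissible sizes, where the quotient is eventually the discrete average.\<close>

lemma has_average_value_mixed:
  fixes R p :: real
  assumes "R > 0" "p0 > 0" "q0 > 0" "even p0" "p = real p0 / real q0"
    and mp: "mesh_parameters m s r" and part: "mesh_partition m s r t" and g: "continuous_on UNIV g"
    and I: "has_line_integral (mixed_integrand g p0 q0 R m s r) I"
  shows "has_average_value g p0 q0 R m s t
     (ereal (1 / (2 * R * Gamma (1/p) * p powr (1/p - 1))) * I)"
proof -
  have p: "p > 0" using assms by simp
  define G where "G u = (\<Sum>j=1..m. s j * r j * g (r j powr (- (1 / p)) * u))" for u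
  define D where "D = 2 * R * Gamma (1 / p) * p powr (1 / p - 1)"
  define N where "N f n = (LINT u|lborel. f u * trunc_weight p (real n) ((\<bar>u\<bar> / R) powr p))"
    for f :: "real \<Rightarrow> real" and n
  have D: "D > 0" using p \<open>R > 0\<close> by (simp add: D_def Gamma_real_pos)
  have G: "continuous_on UNIV G"
    unfolding G_def by (rule continuous_on_mixture[OF g])
  have num: "(\<lambda>n. ereal (N G n)) \<longlonglongrightarrow> I"
    unfolding N_def using I G p \<open>R > 0\<close>
    by (intro trunc_weight_integral_tendsto) (auto simp: mixed_integrand_eq[OF assms(1-5)] G_def)
  have "(\<lambda>n. ereal (N (\<lambda>_. 1) n)) \<longlonglongrightarrow> ereal D"
    unfolding N_def D_def using has_line_integral_gaussian[OF \<open>R > 0\<close> p] p \<open>R > 0\<close>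
    by (intro trunc_weight_integral_tendsto) auto
  then have "(\<lambda>n. 1 / N (\<lambda>_. 1) n) \<longlonglongrightarrow> 1 / D"
    using D by (intro tendsto_divide) auto
  \<comment> \<open>Multiplication is continuous here even for infinite \<open>I\<close>, because
    \<open>1 / D\<close> is neither 0 nor infinite.\<close>
  then have "(\<lambda>n. ereal (1 / N (\<lambda>_. 1) n) * ereal (N G n)) \<longlonglongrightarrow> ereal (1 / D) * I"
    using num D by (intro tendsto_mult_ereal) auto
  then have "(\<lambda>n. ereal (N G n / N (\<lambda>_. 1) n)) \<longlonglongrightarrow> ereal (1 / D) * I"
    by simp
  then have "((\<lambda>n. ereal (N G n / N (\<lambda>_. 1) n)) \<longlongrightarrow> ereal (1 / D) * I) (mesh_sequence m s)"
    by (rule tendsto_mono[rotated]) (simp add: mesh_sequence_def)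
  moreover have "eventually (\<lambda>n. ereal (N G n / N (\<lambda>_. 1) n) =
     ereal (disc_average g (rat_pow p0 q0) (R powr (real p0 / real q0)) n (t n))) (mesh_sequence m s)"
    unfolding mesh_sequence_def eventually_inf_principal
    using eventually_ge_at_top[of 2]
  proof eventually_elim
    case (elim n)
    have "rat_pow p0 q0 = (\<lambda>x. \<bar>x\<bar> powr p)"
      using assms by (simp add: fun_eq_iff rat_pow_eq_powr)
    then show ?case
      using disc_average_eq[OF mp part _ elim g \<open>R > 0\<close> p]
      by (auto simp: N_def G_def \<open>p = real p0 / real q0\<close>[symmetric])
  qed
  ultimately show ?thesis
    unfolding has_average_value_def D_def by (rule Lim_transform_eventually)
qed

text \<open>The condition makes the even part of every rescaled copy of \<open>g\<close> integrable
  against the limit weight; the even part of the mixture is their weighted sum.\<close>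

lemma has_line_integral_mixed:
  fixes R p :: real
  assumes "R > 0" "p0 > 0" "q0 > 0" "even p0" "p = real p0 / real q0" and g: "continuous_on UNIV g"
    and H2: "\<forall>j\<in>{1..m}. condition_H2 p R (\<lambda>x. g (r j powr (- (1/p)) * x))"
  shows "\<exists>I::real. has_line_integral (mixed_integrand g p0 q0 R m s r) (ereal I)"
proof -
  have p: "p > 0" using assms by simp
  define G where "G u = (\<Sum>j=1..m. s j * r j * g (r j powr (- (1 / p)) * u))" for u
  define f where "f x = G x * exp (- ((\<bar>x\<bar> / R) powr p / p))" for x
  have cont: "continuous_on UNIV f"
    unfolding f_def
  proof (intro continuous_on_mult continuous_on_exp continuous_on_minus continuous_on_divide
      continuous_on_const)
    show "continuous_on UNIV G"
      unfolding G_def by (rule continuous_on_mixture[OF g])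
    show "continuous_on UNIV (\<lambda>x. (\<bar>x\<bar> / R) powr p)"
      using p \<open>R > 0\<close> by (intro continuous_on_powr' continuous_intros) auto
  qed (use p in auto)
  have "set_integrable lborel {0..} (\<lambda>u. s j * r j * ((g (r j powr (- (1 / p)) * u) +
      g (r j powr (- (1 / p)) * - u)) * exp (- ((u / R) powr p / p))))" if "j \<in> {1..m}" for j
  proof (intro set_integrable_mult_right, rule condition_H2_imp_set_integrable)
    show "continuous_on UNIV (\<lambda>u. g (r j powr (- (1 / p)) * u))"
      by (intro continuous_on_compose2[OF g] continuous_intros) auto
  qed (use H2 that p \<open>R > 0\<close> in auto)
  then have "set_integrable lborel {0..} (\<lambda>u. \<Sum>j=1..m. s j * r j *
     ((g (r j powr (- (1 / p)) * u) + g (r j powr (- (1 / p)) * - u)) *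
       exp (- ((u / R) powr p / p))))"
    unfolding set_integrable_def scaleR_sum_right by (intro Bochner_Integration.integrable_sum) auto
  also have "?this \<longleftrightarrow> set_integrable lborel {0..} (\<lambda>u. f u + f (- u))"
  proof (intro set_integrable_cong refl)
    fix u :: real
    assume "u \<in> {0..}"
    then have "f u + f (- u) = (G u + G (- u)) * exp (- ((u / R) powr p / p))"
      by (simp add: f_def distrib_right)
    also have "G u + G (- u) = (\<Sum>j=1..m. s j * r j *
        (g (r j powr (- (1 / p)) * u) + g (r j powr (- (1 / p)) * - u)))"
      by (simp add: G_def distrib_left sum.distrib)
    finally show "(\<Sum>j=1..m. s j * r j *
     ((g (r j powr (- (1 / p)) * u) + g (r j powr (- (1 / p)) * - u)) *
       exp (- ((u / R) powr p / p)))) = f u + f (- u)"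
      by (simp only: sum_distrib_right mult.assoc)
  qed
  finally have "has_line_integral f (ereal (LINT x:{0..}|lborel. f x + f (- x)))"
    by (rule has_line_integral_even_part[OF cont])
  moreover have "mixed_integrand g p0 q0 R m s r = f"
    using mixed_integrand_eq[OF assms(1-5)] by (simp add: fun_eq_iff f_def G_def)
  ultimately show ?thesis by auto
qed

section \<open>Two explicit meshes\<close>

lemma mesh_partition_single:
  "mesh_parameters 1 (\<lambda>_. 1) (\<lambda>_. 1)"
  "mesh_partition 1 (\<lambda>_. 1) (\<lambda>_. 1) (\<lambda>n k. real k / real n)"
  by (auto simp: mesh_parameters_def mesh_partition_def mesh_sizes_def divide_strict_right_mono
      of_nat_diff field_simps)

text \<open>Admissible sizes are even. The first \<open>n / 2\<close> intervals have width
  \<open>1 / (2 * n)\<close> and fill \<open>[0, 1/4]\<close>, the others have width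
  \<open>3 / (2 * n)\<close>; the two formulas for \<open>t\<close> agree at
  \<open>k = n / 2\<close>.\<close>

lemma mesh_partition_halves:
  defines "s \<equiv> (\<lambda>_. 1 / 2)" and "r \<equiv> (\<lambda>j. if j = (1::nat) then 1 / 2 else 3 / 2)"
    and "t \<equiv> (\<lambda>n k. if 2 * k \<le> n then real k / (2 * real n) else (3 * real k - real n) / (2 * real n))"
  shows "mesh_parameters 2 s r" "mesh_partition 2 s r t"
proof -
  have two: "{Suc 0..2} = {Suc 0, 2}" "{Suc 0..<2} = {Suc 0}" by auto
  show "mesh_parameters 2 s r"
    by (auto simp: mesh_parameters_def s_def r_def two)
  show "mesh_partition 2 s r t"
    unfolding mesh_partition_def
  proof (intro ballI conjI allI impI)
    fix n assume "n \<in> mesh_sizes 2 s"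
    then have n: "n \<ge> 1" and "real n / 2 \<in> \<int>" by (auto simp: mesh_sizes_def s_def two)
    then obtain i where "real n / 2 = of_int i" by (auto elim: Ints_cases)
    then have "real_of_int (int n) = real_of_int (2 * i)" by simp
    then have "int n = 2 * i" by (simp only: of_int_eq_iff)
    then have ev: "even n" by presburger
    show "t n 0 = 0" by (simp add: t_def)
    show "t n n = 1" using n by (simp add: t_def)
    have step: "t n k - t n (k - 1) = (if 2 * k \<le> n then 1 / 2 else 3 / 2) / real n" if "k \<ge> 1" for k
    proof -
      consider "2 * k \<le> n" | "\<not> 2 * k \<le> n" "2 * (k - 1) \<le> n" | "\<not> 2 * k \<le> n" "\<not> 2 * (k - 1) \<le> n"
        by blast
      then show ?thesis
      proof cases
        \<comment> \<open>The interval just after the middle index: as \<open>n\<close> is even,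
          \<open>k - 1 = n / 2\<close>, where both branches of \<open>t\<close> give
          \<open>1/4\<close>.\<close>
        case 2
        then have "n = 2 * (k - 1)" using ev that by presburger
        then have "real n = 2 * (real k - 1)" using that by (simp add: of_nat_diff)
        then have "t n k = (3 * real k - 2 * (real k - 1)) / (2 * real n)" "t n (k - 1) = (real k - 1) / (2 * real n)"
          using 2 that by (auto simp: t_def of_nat_diff)
        then show ?thesis using 2 n by (simp add: field_simps)
      qed (use n that in \<open>auto simp: t_def of_nat_diff field_simps\<close>)
    qed
    show "t n (k - 1) < t n k" if "k \<in> {1..n}" for k
    proof -
      have "k \<ge> 1" using that by simp
      have "t n k - t n (k - 1) > 0" unfolding step[OF \<open>k \<ge> 1\<close>] using n by simp
      then show ?thesis by simp
    qed
    show "t n k - t n (k - 1) = r j / real n"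
      if "j \<in> {1..2}" "sum s {1..<j} * real n + 1 \<le> real k \<and> real k \<le> sum s {1..j} * real n" for j k
    proof -
      have "k \<ge> 1" using that by (auto simp: two s_def)
      moreover have "(2 * k \<le> n) = (j = 1)" using that by (auto simp: two s_def)
      ultimately show ?thesis using step[of k] by (simp add: r_def)
    qed
  qed
qed

section \<open>An integrand that distinguishes the two meshes\<close>

lemma abs_powr_has_real_derivative:
  fixes q x :: real
  assumes "q > 1"
  shows "((\<lambda>x. \<bar>x\<bar> powr q) has_real_derivative q * sgn x * \<bar>x\<bar> powr (q - 1)) (at x)"
proof (cases "x = 0")
  case True
  \<comment> \<open>The difference quotient at 0 has modulus
    \<open>\<bar>h\<bar> powr (q - 1)\<close>, which tends to 0 because
    \<open>q > 1\<close>.\<close>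
  have "((\<lambda>h. h * \<bar>h\<bar> powr (q - 2)) \<longlongrightarrow> 0) (at (0::real))"
  proof (rule tendsto_rabs_zero_cancel)
    have "((\<lambda>h. \<bar>h\<bar> powr (q - 1)) \<longlongrightarrow> 0) (at (0::real))"
      using assms by (intro tendsto_zero_powrI tendsto_eq_intros) auto
    then show "((\<lambda>h. \<bar>h * \<bar>h\<bar> powr (q - 2)\<bar>) \<longlongrightarrow> 0) (at (0::real))"
    proof (rule Lim_transform_eventually)
      show "eventually (\<lambda>h. \<bar>h\<bar> powr (q - 1) = \<bar>h * \<bar>h\<bar> powr (q - 2)\<bar>) (at (0::real))"
        by (auto simp: eventually_at_filter abs_mult powr_mult_base)
    qed
  qed
  then have "((\<lambda>h. \<bar>h\<bar> powr q / h) \<longlongrightarrow> 0) (at (0::real))"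
  proof (rule Lim_transform_eventually)
    show "eventually (\<lambda>h. h * \<bar>h\<bar> powr (q - 2) = \<bar>h\<bar> powr q / h) (at (0::real))"
      by (auto simp: eventually_at_filter powr_diff power2_eq_square abs_if)
  qed
  then show ?thesis using True by (simp add: DERIV_def)
next
  case False
  then consider "x > 0" | "x < 0" by linarith
  then show ?thesis
  proof cases
    case 1
    have "((\<lambda>x. x powr q) has_real_derivative q * x powr (q - 1)) (at x)"
      using 1 by (auto intro!: derivative_eq_intros)
    moreover have "eventually (\<lambda>y. y powr q = \<bar>y\<bar> powr q) (nhds x)"
      using eventually_nhds_in_open[of "{0<..}" x] 1 by (auto elim!: eventually_mono)
    ultimately show ?thesis using 1 by (subst (asm) DERIV_cong_ev) auto
  next
    case 2
    have "((\<lambda>x. (- x) powr q) has_real_derivative - (q * (- x) powr (q - 1))) (at x)"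
      using 2 by (auto intro!: derivative_eq_intros)
    moreover have "eventually (\<lambda>y. (- y) powr q = \<bar>y\<bar> powr q) (nhds x)"
      using eventually_nhds_in_open[of "{..<0}" x] 2 by (auto elim!: eventually_mono)
    ultimately show ?thesis using 2 by (subst (asm) DERIV_cong_ev) auto
  qed
qed

text \<open>Writing the function as a difference of powers of \<open>max 0 x\<close> and
  \<open>max 0 (- x)\<close> removes the discontinuous factor \<open>sgn x\<close>.\<close>

lemma continuous_sgn_abs_powr:
  fixes q :: real
  assumes "q > 0"
  shows "continuous_on UNIV (\<lambda>x. sgn x * \<bar>x\<bar> powr q)"
proof -
  have "(\<lambda>x. sgn x * \<bar>x\<bar> powr q) = (\<lambda>x. max 0 x powr q - max 0 (- x) powr q)"
    by (auto simp: fun_eq_iff sgn_if max_def)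
  moreover have "continuous_on UNIV (\<lambda>x. max 0 x powr q - max 0 (- x) powr q)"
    using assms
    by (intro continuous_on_diff continuous_on_powr' continuous_on_max continuous_intros) auto
  ultimately show ?thesis by metis
qed

text \<open>With exponent \<open>2p - 1\<close> the function \<open>r\<close> of the first growth condition is linear.\<close>

lemma condition_H1_abs_powr:
  fixes p R :: real
  assumes "R > 0" "p > 1"
  shows "condition_H1 p R (\<lambda>x. \<bar>x\<bar> powr (2 * p - 1))"
proof -
  define q where "q = 2 * p - 1"
  \<comment> \<open>Order 1 is enough: \<open>e\<close> lists the integrand and its derivative,
    \<open>d\<close> a linear function and its constant slope.\<close>
  define e where "e j x = (if j = (0::nat) then \<bar>x\<bar> powr q else q * (sgn x * \<bar>x\<bar> powr (q - 1)))" for j x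
  define d where "d j x = (if j = (0::nat) then 2 * R powr q * x else 2 * R powr q)" for j and x :: real
  have q: "q > 1" using assms by (simp add: q_def)
  have e: "e 0 = (\<lambda>x. \<bar>x\<bar> powr q)" "e (Suc 0) = (\<lambda>x. q * (sgn x * \<bar>x\<bar> powr (q - 1)))"
    by (simp_all add: e_def fun_eq_iff)
  have d: "d 0 = (\<lambda>x. 2 * R powr q * x)" "d (Suc 0) = (\<lambda>_. 2 * R powr q)"
    by (simp_all add: d_def fun_eq_iff)
  have "Ck_derivatives_on 1 UNIV e"
    using abs_powr_has_real_derivative[OF q] continuous_sgn_abs_powr[of "q - 1"] q
    by (auto simp: Ck_derivatives_on_def e mult.assoc intro!: continuous_on_mult_left)
  moreover have "e 0 = (\<lambda>x. \<bar>x\<bar> powr (2 * p - 1))" by (simp add: e_def q_def fun_eq_iff)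
  moreover have "Ck_derivatives_on 1 {0..} d"
    by (auto simp: Ck_derivatives_on_def d intro!: derivative_eq_intros)
  moreover have "d 0 x = x powr (1/p - 1) * (\<bar>R * x powr (1/p)\<bar> powr (2 * p - 1) +
      \<bar>- R * x powr (1/p)\<bar> powr (2 * p - 1))" if "x > 0" for x
  proof -
    \<comment> \<open>The exponent \<open>q\<close> is chosen so that
      \<open>1 / p - 1 + q / p = 1\<close>.\<close>
    have "x powr (1 / p - 1) * x powr (1 / p * q) = x powr 1"
      unfolding powr_add[symmetric] using assms by (simp add: q_def field_simps)
    then have "x powr (1 / p - 1) * (x powr (1 / p)) powr q = x"
      using that by (simp add: powr_powr)
    then show ?thesis
      using that assms
      by (simp add: d_def abs_mult powr_mult flip: q_def)
  qed
  moreover have "((\<lambda>x. d j x * exp (- x)) \<longlongrightarrow> 0) at_top" if "j < 1" for j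
    unfolding d_def using that assms by simp real_asymp
  moreover have "\<exists>A>0. \<forall>x\<ge>0. \<bar>d 1 x\<bar> \<le> A"
    using assms by (intro exI[of _ "2 * R powr q"]) (auto simp: d_def)
  ultimately show ?thesis
    unfolding condition_H1_def by (intro exI[of _ "1::nat"] conjI exI[of _ e] exI[of _ d]) auto
qed

text \<open>By homogeneity, rescaling the argument only produces constants, so the mesh enters
  through one number, the sum of the \<open>s j * r j powr (1 - q / p)\<close>.\<close>

lemma mixture_abs_powr:
  fixes p :: real
  assumes "\<forall>j\<in>{1..m}. r j > 0"
  shows "(\<Sum>j=1..m. s j * r j * \<bar>r j powr (- (1 / p)) * x\<bar> powr q) =
    (\<Sum>j=1..m. s j * r j powr (1 - q / p)) * \<bar>x\<bar> powr q"
  unfolding sum_distrib_right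
proof (intro sum.cong refl)
  fix j assume "j \<in> {1..m}"
  then have r: "r j > 0" using assms by simp
  then have "r j powr (1 - q / p) = r j * r j powr (- (q / p))"
    using powr_add[of "r j" 1 "- (q / p)"] by simp
  then show "s j * r j * \<bar>r j powr (- (1 / p)) * x\<bar> powr q = s j * r j powr (1 - q / p) * \<bar>x\<bar> powr q"
    using r by (simp add: abs_mult powr_mult powr_powr)
qed

text \<open>By the arithmetic-geometric mean inequality the sum is at least \<open>2 (4/3) powr (a / 2)\<close>.\<close>

lemma half_three_halves_powr:
  fixes a :: real
  assumes "a > 0"
  shows "(1/2) powr (- a) + (3/2) powr (- a) > 2"
proof -
  define u v where "u = (1/2 :: real) powr (- a / 2)" and "v = (3/2 :: real) powr (- a / 2)"
  have "u * v = (3/4) powr (- a / 2)"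
    by (simp add: u_def v_def flip: powr_mult)
  also have "\<dots> > 1"
    using assms powr_less_mono2_neg[of "- a / 2" "3/4" 1] by simp
  finally have "u * v > 1" .
  moreover have "(1/2) powr (- a) = u ^ 2" "(3/2) powr (- a) = v ^ 2"
    by (simp_all add: u_def v_def power2_eq_square flip: powr_add)
  moreover have "(u - v) ^ 2 \<ge> 0" by simp
  ultimately show ?thesis by (simp add: power2_diff)
qed

lemma has_line_integral_cmult:
  assumes "has_line_integral f (ereal J)"
  shows "has_line_integral (\<lambda>x. c * f x) (ereal (c * J))"
  using tendsto_mult_left[of "\<lambda>T. LINT x:{-T..T}|lborel. f x" J at_top c] assms
  by (simp add: has_line_integral_def)

text \<open>On \<open>[1, 2]\<close> the nonnegative integrand is at least \<open>b > 0\<close>, so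
  all integrals over \<open>[-T, T]\<close> with \<open>T \<ge> 2\<close> are at least
  \<open>b\<close>, and so is their limit.\<close>

lemma has_line_integral_abs_powr_pos:
  fixes p q R J :: real
  assumes "R > 0" "p > 0" "q > 0"
    and J: "has_line_integral (\<lambda>x. \<bar>x\<bar> powr q * exp (- ((\<bar>x\<bar> / R) powr p / p))) (ereal J)"
  shows "J > 0"
proof -
  define f where "f x = \<bar>x\<bar> powr q * exp (- ((\<bar>x\<bar> / R) powr p / p))" for x
  define b where "b = exp (- ((2 / R) powr p / p))"
  have "continuous_on UNIV (\<lambda>x. (\<bar>x\<bar> / R) powr p)"
    using assms by (intro continuous_on_powr' continuous_intros) auto
  moreover have "continuous_on UNIV (\<lambda>x::real. \<bar>x\<bar> powr q)"
    using assms by (intro continuous_on_powr' continuous_intros) auto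
  ultimately have cont: "continuous_on UNIV f"
    unfolding f_def using assms
    by (intro continuous_on_mult continuous_on_exp continuous_on_minus continuous_on_divide
        continuous_on_const) auto
  have "b \<le> (LINT x:{-T..T}|lborel. f x)" if "T \<ge> 2" for T
  proof -
    have "b = (LINT x:{1..2::real}|lborel. b)" by (simp add: set_lebesgue_integral_def)
    also have "\<dots> \<le> (LINT x:{-T..T}|lborel. f x)"
      unfolding set_lebesgue_integral_def
    proof (rule integral_mono)
      show "integrable lborel (\<lambda>x. indicator {1..2::real} x *\<^sub>R b)" by simp
      show "integrable lborel (\<lambda>x. indicator {-T..T} x *\<^sub>R f x)"
        by (intro borel_integrable_compact continuous_on_subset[OF cont]) auto
      fix x :: real
      show "indicator {1..2} x *\<^sub>R b \<le> indicator {-T..T} x *\<^sub>R f x"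
      proof (cases "x \<in> {1..2}")
        case True
        have "1 * b \<le> f x"
          unfolding f_def b_def
        proof (intro mult_mono)
          show "1 \<le> \<bar>x\<bar> powr q" using True assms by (intro ge_one_powr_ge_zero) auto
          have "(\<bar>x\<bar> / R) powr p \<le> (2 / R) powr p"
            using True assms by (intro powr_mono2 divide_right_mono) auto
          then show "exp (- ((2 / R) powr p / p)) \<le> exp (- ((\<bar>x\<bar> / R) powr p / p))"
            using assms by (simp add: divide_right_mono)
        qed auto
        then show ?thesis using True that by simp
      qed (simp add: f_def)
    qed
    finally show ?thesis .
  qed
  then have "eventually (\<lambda>T. b \<le> (LINT x:{-T..T}|lborel. f x)) at_top"
    by (auto simp: eventually_at_top_linorder)
  moreover have "((\<lambda>T. LINT x:{-T..T}|lborel. f x) \<longlongrightarrow> J) at_top"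
    using J by (simp add: has_line_integral_def f_def)
  ultimately have "b \<le> J"
    by (intro tendsto_lowerbound) auto
  then show ?thesis by (simp add: b_def less_le_trans[OF exp_gt_zero])
qed

text \<open>Under the second condition alone, the rescaled functions with \<open>r j < 1\<close> may
  have divergent integrals. The formula is therefore asserted for every limit \<open>I\<close> in
  the extended reals, and a finite \<open>I\<close> is provided under the first condition or when
  all rescaled functions satisfy the second. The last conjunct gives one integrand with two
  different finite averages.\<close>

theorem theorem7:
  fixes R p :: real and p0 q0 :: nat
  assumes "R > 0" and "p0 > 0" and "q0 > 0" and "even p0" and "coprime p0 q0"
    and "p = real p0 / real q0" and "p \<ge> 1"
  shows "(\<forall>m s r t g.
      mesh_parameters m s r \<and> mesh_partition m s r t \<and> continuous_on UNIV g \<and>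
      (condition_H1 p R g \<or> condition_H2 p R g) \<longrightarrow>
        (\<forall>I. has_line_integral (mixed_integrand g p0 q0 R m s r) I \<longrightarrow>
           has_average_value g p0 q0 R m s t
             (ereal (1 / (2 * R * Gamma (1/p) * p powr (1/p - 1))) * I)) \<and>
        (condition_H1 p R g \<or>
         (\<forall>j\<in>{1..m}. condition_H2 p R (\<lambda>x. g (r j powr (- (1/p)) * x))) \<longrightarrow>
           (\<exists>I::real. has_line_integral (mixed_integrand g p0 q0 R m s r) (ereal I)))) \<and>
    (\<exists>g m s r t m' s' r' t' L L'.
      continuous_on UNIV g \<and> condition_H1 p R g \<and> condition_H2 p R g \<and>
      mesh_parameters m s r \<and> mesh_partition m s r t \<and>
      mesh_parameters m' s' r' \<and> mesh_partition m' s' r' t' \<and>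
      has_average_value g p0 q0 R m s t (ereal L) \<and>
      has_average_value g p0 q0 R m' s' t' (ereal L') \<and> L \<noteq> L')"
proof (rule conjI)
  have p0: "p > 0" using assms by simp
  show "\<forall>m s r t g.
      mesh_parameters m s r \<and> mesh_partition m s r t \<and> continuous_on UNIV g \<and>
      (condition_H1 p R g \<or> condition_H2 p R g) \<longrightarrow>
        (\<forall>I. has_line_integral (mixed_integrand g p0 q0 R m s r) I \<longrightarrow>
           has_average_value g p0 q0 R m s t
             (ereal (1 / (2 * R * Gamma (1/p) * p powr (1/p - 1))) * I)) \<and>
        (condition_H1 p R g \<or>
         (\<forall>j\<in>{1..m}. condition_H2 p R (\<lambda>x. g (r j powr (- (1/p)) * x))) \<longrightarrow>
           (\<exists>I::real. has_line_integral (mixed_integrand g p0 q0 R m s r) (ereal I)))"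
  proof (intro allI impI, elim conjE, intro conjI allI impI)
    fix m s r t and g :: "real \<Rightarrow> real" and I
    assume "mesh_parameters m s r" "mesh_partition m s r t" "continuous_on UNIV g"
      "has_line_integral (mixed_integrand g p0 q0 R m s r) I"
    then show "has_average_value g p0 q0 R m s t
             (ereal (1 / (2 * R * Gamma (1/p) * p powr (1/p - 1))) * I)"
      using assms by (intro has_average_value_mixed)
  next
    fix m s r t and g :: "real \<Rightarrow> real"
    assume mp: "mesh_parameters m s r" and g: "continuous_on UNIV g"
      and H: "condition_H1 p R g \<or>
        (\<forall>j\<in>{1..m}. condition_H2 p R (\<lambda>x. g (r j powr (- (1/p)) * x)))"
    have "\<forall>j\<in>{1..m}. condition_H2 p R (\<lambda>x. g (r j powr (- (1/p)) * x))"
      using H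
    proof
      assume "condition_H1 p R g"
      then show ?thesis
        using mp assms(1) p0 g by (auto simp: mesh_parameters_def intro: condition_H1_imp_scaled_H2)
    qed
    then show "\<exists>I::real. has_line_integral (mixed_integrand g p0 q0 R m s r) (ereal I)"
      using assms g by (intro has_line_integral_mixed)
  qed
next
  \<comment> \<open>\<open>p = 1\<close> would force \<open>p0 = q0\<close>, but an even number is
    not coprime to itself. Strictness makes \<open>1 - 1 / p\<close> positive, on which the
    comparison of the two meshes rests.\<close>
  have "p \<noteq> 1"
  proof
    assume "p = 1"
    then have "p0 = q0" using assms by simp
    then show False using assms by simp
  qed
  then have p: "p > 1" using assms by simp
  define q where "q = 2 * p - 1"
  define g where "g x = \<bar>x\<bar> powr q" for x :: real
  define f where "f x = \<bar>x\<bar> powr q * exp (- ((\<bar>x\<bar> / R) powr p / p))" for x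
  define K where "K = 1 / (2 * R * Gamma (1/p) * p powr (1/p - 1))"
  have q: "q > 1" using p by (simp add: q_def)
  have K: "K > 0" using p assms(1) by (simp add: K_def Gamma_real_pos)
  have g: "continuous_on UNIV g"
    unfolding g_def using q by (intro continuous_on_powr' continuous_intros) auto
  have H1: "condition_H1 p R g"
    using condition_H1_abs_powr[of R p] p assms(1) by (simp add: g_def[abs_def] q_def)
  have H2s: "condition_H2 p R (\<lambda>x. g (\<rho> powr (- (1 / p)) * x))" if "\<rho> > 0" for \<rho>
    using condition_H1_imp_scaled_H2[OF assms(1) _ that g H1] p by simp
  have H2: "condition_H2 p R g" using H2s[of 1] by simp
  have mixed: "mixed_integrand g p0 q0 R m s r =
      (\<lambda>x. (\<Sum>j=1..m. s j * r j powr (1 - q / p)) * f x)" if "mesh_parameters m s r" for m s r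
    using that mixture_abs_powr[of m r s p _ q]
    unfolding mixed_integrand_eq[OF assms(1-4) assms(6)]
    by (simp add: fun_eq_iff f_def g_def mesh_parameters_def mult.assoc)
  define s :: "nat \<Rightarrow> real" where "s = (\<lambda>_. 1 / 2)"
  define r :: "nat \<Rightarrow> real" where "r = (\<lambda>j. if j = 1 then 1 / 2 else 3 / 2)"
  obtain t where mp: "mesh_parameters 2 s r" "mesh_partition 2 s r t"
    using mesh_partition_halves unfolding s_def r_def by blast
  have "mixed_integrand g p0 q0 R 1 (\<lambda>_. 1) (\<lambda>_. 1) = f"
    using mixed[OF mesh_partition_single(1)] by simp
  moreover obtain J where "has_line_integral (mixed_integrand g p0 q0 R 1 (\<lambda>_. 1) (\<lambda>_. 1)) (ereal J)"
    using has_line_integral_mixed[OF assms(1-4) assms(6) g, of 1 "\<lambda>_. 1" "\<lambda>_. 1"] H2 by auto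
  ultimately have J: "has_line_integral (mixed_integrand g p0 q0 R 1 (\<lambda>_. 1) (\<lambda>_. 1)) (ereal J)"
    "has_line_integral f (ereal J)" by simp_all
  have "J > 0"
    using has_line_integral_abs_powr_pos[of R p q J] J(2) p q assms(1) by (simp add: f_def[abs_def])
  \<comment> \<open>The ratio of the average on the two-block mesh to that on the uniform mesh, for
    which the corresponding sum is 1.\<close>
  define c where "c = (\<Sum>j=1..2. s j * r j powr (1 - q / p))"
  have J': "has_line_integral (mixed_integrand g p0 q0 R 2 s r) (ereal (c * J))"
    unfolding mixed[OF mp(1)] c_def by (rule has_line_integral_cmult[OF J(2)])
  have "1 - q / p = - (1 - 1 / p)" using p by (simp add: q_def field_simps)
  then have "c = ((1/2) powr (- (1 - 1 / p)) + (3/2) powr (- (1 - 1 / p))) / 2"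
    by (simp only: c_def) (simp add: s_def r_def numeral_2_eq_2)
  moreover have "1 - 1 / p > 0" using p by simp
  ultimately have c: "c > 1" using half_three_halves_powr[of "1 - 1 / p"] by simp
  have "has_average_value g p0 q0 R 1 (\<lambda>_. 1) (\<lambda>n k. real k / real n) (ereal (K * J))"
    using has_average_value_mixed[OF assms(1-4) assms(6) mesh_partition_single g J(1)]
    by (simp add: K_def)
  moreover have "has_average_value g p0 q0 R 2 s t (ereal (K * (c * J)))"
    using has_average_value_mixed[OF assms(1-4) assms(6) mp g J'] by (simp add: K_def)
  moreover have "K * J \<noteq> K * (c * J)" using K c \<open>J > 0\<close> by simp
  ultimately show "\<exists>g m s r t m' s' r' t' L L'.
      continuous_on UNIV g \<and> condition_H1 p R g \<and> condition_H2 p R g \<and>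
      mesh_parameters m s r \<and> mesh_partition m s r t \<and>
      mesh_parameters m' s' r' \<and> mesh_partition m' s' r' t' \<and>
      has_average_value g p0 q0 R m s t (ereal L) \<and>
      has_average_value g p0 q0 R m' s' t' (ereal L') \<and> L \<noteq> L'"
    using g H1 H2 mesh_partition_single mp by blast
qed

end
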